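(* Let $\underline{\mathsf{Cyl}}=(\mathsf{Cyl},i_0,i_1,p,v,\mathsf S,r_0,r_1,s,\Gamma_{lr})$ be a cylinder in a formal category $\mathcal A$ equipped with a contraction structure $p$, an involution structure $v$ compatible with $p$, a subdivision structure $(\mathsf S,r_0,r_1,s)$, and a lower right connection structure $\Gamma_{lr}$. Suppose that $\Gamma_{lr}$ is compatible with $p$, that $\underline{\mathsf{Cyl}}$ has strictness of identities, and that $\mathsf{Cyl}$ preserves mapping cylinders with respect to $\underline{\mathsf{Cyl}}$. Let $\underline{\mathsf{coCyl}}=(\mathsf{coCyl},e_0,e_1,c)$ be a co-cylinder in $\mathcal A$ equipped with a contraction structure $c$. Suppose that $\underline{\mathsf{Cyl}}$ is left adjoint to $\underline{\mathsf{coCyl}}$, and that the adjunction between $\mathsf{Cyl}$ and $\mathsf{coCyl}$ is compatible with $p$ and $c$. Let $f:a_0\to a_1$ be an arrow of $\mathcal A$, let $(a_f,d^0_f,d^1_f)$ be a mapping cylinder of $f$ with respect to $\underline{\mathsf{Cyl}}$, and let $f=g\circ j$, with $j:a_0\to a_f$ and $g:a_f\to a_1$, be the corresponding mapping cylinder factorisation of $f$. Then $j$ is a normally cloven cofibration with respect to $\underline{\mathsf{Cyl}}$, and $g$ is a trivial fibration with respect to $\underline{\mathsf{coCyl}}$.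
   Context: Formal categories. Let $\mathcal C$ be a strict 2-category with a final object $1$. For an object $\mathcal A$ of $\mathcal C$, an object of $\mathcal A$ is a 1-arrow $1\to\mathcal A$ and an arrow of $\mathcal A$ is a 2-arrow between such; composition, commutative diagrams, pushouts and pullbacks in $\mathcal A$ are those of the category $\mathrm{Hom}_{\mathcal C}(1,\mathcal A)$. For 1-arrows $F,F_0,F_1:\mathcal A\to\mathcal A$, a 2-arrow $\eta:F_0\to F_1$, an object $a$ and an arrow $f$ of $\mathcal A$: $F(a)=F\circ a$, $F(f)$ is the whiskering of $F$ and $f$, $\eta(a):F_0(a)\to F_1(a)$ is the whiskering of $\eta$ and $a$; $F\cdot\eta$, $\eta\cdot F$ are whiskerings. Standing assumption: for all objects $\mathcal A_0,\mathcal A_1$ of $\mathcal C$ and objects $a$ of $\mathcal A_0$, evaluation at $a$ sends pushout (resp. pullback) squares of $\mathrm{Hom}_{\mathcal C}(\mathcal A_0,\mathcal A_1)$ to pushout (resp. pullback) squares of $\mathcal A_1$. (For $\mathcal C$ the 2-category of categories these are ordinary categories, functors and natural transformations.) $\mathcal A$ is a fixed object of $\mathcal C$. A cylinder in $\mathcal A$ is a 1-arrow $\mathsf{Cyl}:\mathcal A\to\mathcal A$ with 2-arrows $i_0,i_1:\mathrm{id}_{\mathcal A}\to\mathsf{Cyl}$. Contraction: $p:\mathsf{Cyl}\to\mathrm{id}_{\mathcal A}$ with $pi_0=pi_1=\mathrm{id}$. Involution: $v:\mathsf{Cyl}\to\mathsf{Cyl}$ with $vi_0=i_1$, $vi_1=i_0$;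 compatible with $p$ if $pv=p$. Subdivision: a 1-arrow $\mathsf S:\mathcal A\to\mathcal A$, 2-arrows $r_0,r_1:\mathsf{Cyl}\to\mathsf S$ with $r_0i_0=r_1i_1$ a pushout square of $i_0$ and $i_1$ in $\mathrm{Hom}_{\mathcal C}(\mathcal A,\mathcal A)$, and $s:\mathsf{Cyl}\to\mathsf S$ with $si_0=r_1i_0$, $si_1=r_0i_1$. Lower right connection: $\Gamma_{lr}:\mathsf{Cyl}^2\to\mathsf{Cyl}$ with $\Gamma_{lr}(i_1\cdot\mathsf{Cyl})=\Gamma_{lr}(\mathsf{Cyl}\cdot i_1)=\mathrm{id}$, $\Gamma_{lr}(i_0\cdot\mathsf{Cyl})=\Gamma_{lr}(\mathsf{Cyl}\cdot i_0)=i_0p$; compatible with $p$ if $p\Gamma_{lr}=p(p\cdot\mathsf{Cyl})$. Strictness of identities: $q_ls=\mathrm{id}=q_rs$, where $q_l,q_r:\mathsf S\to\mathsf{Cyl}$ are the unique 2-arrows with $q_lr_0=\mathrm{id}$, $q_lr_1=i_0p$, $q_rr_0=i_1p$, $q_rr_1=\mathrm{id}$. A co-cylinder in $\mathcal A$ is a 1-arrow $\mathsf{coCyl}:\mathcal A\to\mathcal A$ with 2-arrows $e_0,e_1:\mathsf{coCyl}\to\mathrm{id}_{\mathcal A}$; a contraction structure on it is $c:\mathrm{id}_{\mathcal A}\to\mathsf{coCyl}$ with $e_0c=e_1c=\mathrm{id}$. $\underline{\mathsf{Cyl}}$ is left adjoint to $\underline{\mathsf{coCyl}}$ if $\mathsf{Cyl}$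 is left adjoint to $\mathsf{coCyl}$ in $\mathcal C$, with natural bijection $\mathsf{adj}:\mathrm{Hom}_{\mathcal A}(\mathsf{Cyl}(a_0),a_1)\to\mathrm{Hom}_{\mathcal A}(a_0,\mathsf{coCyl}(a_1))$, and $e_\epsilon(a_1)\circ\mathsf{adj}(h)=h\circ i_\epsilon(a_0)$ for $\epsilon=0,1$ and all $h$. The adjunction is compatible with $p$ and $c$ if $\mathsf{adj}(f\circ p(a_0))=c(a_1)\circ f$ for all $f:a_0\to a_1$. Mapping cylinder of $f:a_0\to a_1$: an object $a_f$ with $d^0_f:\mathsf{Cyl}(a_0)\to a_f$, $d^1_f:a_1\to a_f$ such that $d^0_f\circ i_0(a_0)=d^1_f\circ f$ is a pushout square. $\mathsf{Cyl}$ preserves mapping cylinders if it carries each such square to a pushout square (with maps $\mathsf{Cyl}(i_0(a_0)),\mathsf{Cyl}(d^0_f),\mathsf{Cyl}(f),\mathsf{Cyl}(d^1_f)$). Mapping cylinder factorisation: $j=d^0_f\circ i_1(a_0)$, and $g:a_f\to a_1$ is the unique arrow with $g\circ d^0_f=f\circ p(a_0)$, $g\circ d^1_f=\mathrm{id}$. Normally cloven cofibration with respect to $\underline{\mathsf{Cyl}}$: $j:a_0\to a_1$ for which one can choose, for every object $a_2$ and all $g:a_1\to a_2$, $h:\mathsf{Cyl}(a_0)\to a_2$ with $h\circ i_0(a_0)=g\circ j$, an arrow $k_{a_2}(g,h):\mathsf{Cyl}(a_1)\to a_2$ with $k_{a_2}(g,h)\circ\mathsf{Cyl}(j)=h$,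 $k_{a_2}(g,h)\circ i_0(a_1)=g$, such that (i) $k_{a_2}(g,g\circ j\circ p(a_0))=g\circ p(a_1)$, and (ii) $g'\circ k_{a_2}(g,h)=k_{a_3}(g'\circ g,g'\circ h)$ for all $g':a_2\to a_3$. A homotopy from $f_0$ to $f_1$ ($f_0,f_1:a_0\to a_1$) with respect to $\underline{\mathsf{coCyl}}$ is $h:a_0\to\mathsf{coCyl}(a_1)$ with $e_0(a_1)\circ h=f_0$, $e_1(a_1)\circ h=f_1$; $f$ is a homotopy equivalence if there are $f^{-1}$ and homotopies from $f^{-1}f$ and $ff^{-1}$ to the identities. Fibration with respect to $\underline{\mathsf{coCyl}}$: $f:a_1\to a_2$ such that for all $g:a_0\to a_1$, $h:a_0\to\mathsf{coCyl}(a_2)$ with $e_0(a_2)\circ h=f\circ g$ there is $k:a_0\to\mathsf{coCyl}(a_1)$ with $\mathsf{coCyl}(f)\circ k=h$, $e_0(a_1)\circ k=g$. Trivial fibration: both a fibration and a homotopy equivalence with respect to $\underline{\mathsf{coCyl}}$. *)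

theory Defs
  imports Main
begin

text \<open>
  A 2-category is given by carriers of objects, 1-arrows and 2-arrows, with all
  operations relevant only on these carriers. All compositions are written in the
  classical order: \<open>G \<odot> F\<close> is \<open>F\<close> followed by \<open>G\<close>, \<open>\<beta> \<cdot> \<alpha>\<close> is the vertical composite
  \<open>\<alpha>\<close> followed by \<open>\<beta>\<close>, and \<open>\<beta> \<star> \<alpha>\<close> is the horizontal composite lying over \<open>G \<odot> F\<close>.
\<close>

record ('o, 'm, 't) two_cat =
  Ob :: "'o set"
  Ar1 :: "'m set"
  Ar2 :: "'t set"
  dom1 :: "'m \<Rightarrow> 'o"
  cod1 :: "'m \<Rightarrow> 'o"
  dom2 :: "'t \<Rightarrow> 'm"
  cod2 :: "'t \<Rightarrow> 'm"
  id1 :: "'o \<Rightarrow> 'm"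
  id2 :: "'m \<Rightarrow> 't"
  comp1 :: "'m \<Rightarrow> 'm \<Rightarrow> 'm"  (infixl "\<odot>\<index>" 70)
  vcomp :: "'t \<Rightarrow> 't \<Rightarrow> 't"  (infixl "\<cdot>\<index>" 70)
  hcomp :: "'t \<Rightarrow> 't \<Rightarrow> 't"  (infixl "\<star>\<index>" 75)

definition hom1 :: "('o, 'm, 't, 'z) two_cat_scheme \<Rightarrow> 'o \<Rightarrow> 'o \<Rightarrow> 'm set" where
  "hom1 C A B = {F \<in> Ar1 C. dom1 C F = A \<and> cod1 C F = B}"

definition hom2 :: "('o, 'm, 't, 'z) two_cat_scheme \<Rightarrow> 'm \<Rightarrow> 'm \<Rightarrow> 't set" where
  "hom2 C F G = {\<alpha> \<in> Ar2 C. dom2 C \<alpha> = F \<and> cod2 C \<alpha> = G}"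

definition lwhisker :: "('o, 'm, 't, 'z) two_cat_scheme \<Rightarrow> 'm \<Rightarrow> 't \<Rightarrow> 't"  (infixr "\<rhd>\<index>" 76) where
  "F \<rhd>\<^bsub>C\<^esub> \<alpha> = id2 C F \<star>\<^bsub>C\<^esub> \<alpha>"

definition rwhisker :: "('o, 'm, 't, 'z) two_cat_scheme \<Rightarrow> 't \<Rightarrow> 'm \<Rightarrow> 't"  (infixl "\<lhd>\<index>" 77) where
  "\<alpha> \<lhd>\<^bsub>C\<^esub> F = \<alpha> \<star>\<^bsub>C\<^esub> id2 C F"

locale strict_2_category =
  fixes C :: "('o, 'm, 't, 'z) two_cat_scheme" (structure)
  assumes dom1_Ob: "F \<in> Ar1 C \<Longrightarrow> dom1 C F \<in> Ob C"
    and cod1_Ob: "F \<in> Ar1 C \<Longrightarrow> cod1 C F \<in> Ob C"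
    and dom2_Ar1: "\<alpha> \<in> Ar2 C \<Longrightarrow> dom2 C \<alpha> \<in> Ar1 C"
    and cod2_Ar1: "\<alpha> \<in> Ar2 C \<Longrightarrow> cod2 C \<alpha> \<in> Ar1 C"
    and dom1_parallel: "\<alpha> \<in> Ar2 C \<Longrightarrow> dom1 C (dom2 C \<alpha>) = dom1 C (cod2 C \<alpha>)"
    and cod1_parallel: "\<alpha> \<in> Ar2 C \<Longrightarrow> cod1 C (dom2 C \<alpha>) = cod1 C (cod2 C \<alpha>)"
    and id1_hom: "A \<in> Ob C \<Longrightarrow> id1 C A \<in> hom1 C A A"
    and comp1_hom: "\<lbrakk>F \<in> hom1 C A B; G \<in> hom1 C B D\<rbrakk> \<Longrightarrow> G \<odot> F \<in> hom1 C A D"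
    and comp1_id_left: "F \<in> hom1 C A B \<Longrightarrow> id1 C B \<odot> F = F"
    and comp1_id_right: "F \<in> hom1 C A B \<Longrightarrow> F \<odot> id1 C A = F"
    and comp1_assoc: "\<lbrakk>F \<in> hom1 C A B; G \<in> hom1 C B D; H \<in> hom1 C D E\<rbrakk>
          \<Longrightarrow> (H \<odot> G) \<odot> F = H \<odot> (G \<odot> F)"
    and id2_hom: "F \<in> Ar1 C \<Longrightarrow> id2 C F \<in> hom2 C F F"
    and vcomp_hom: "\<lbrakk>\<alpha> \<in> hom2 C F G; \<beta> \<in> hom2 C G H\<rbrakk> \<Longrightarrow> \<beta> \<cdot> \<alpha> \<in> hom2 C F H"
    and vcomp_id_left: "\<alpha> \<in> hom2 C F G \<Longrightarrow> id2 C G \<cdot> \<alpha> = \<alpha>"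
    and vcomp_id_right: "\<alpha> \<in> hom2 C F G \<Longrightarrow> \<alpha> \<cdot> id2 C F = \<alpha>"
    and vcomp_assoc: "\<lbrakk>\<alpha> \<in> hom2 C F G; \<beta> \<in> hom2 C G H; \<gamma> \<in> hom2 C H K\<rbrakk>
          \<Longrightarrow> (\<gamma> \<cdot> \<beta>) \<cdot> \<alpha> = \<gamma> \<cdot> (\<beta> \<cdot> \<alpha>)"
    and hcomp_hom: "\<lbrakk>F \<in> hom1 C A B; G \<in> hom1 C B D; \<alpha> \<in> hom2 C F F'; \<beta> \<in> hom2 C G G'\<rbrakk>
          \<Longrightarrow> \<beta> \<star> \<alpha> \<in> hom2 C (G \<odot> F) (G' \<odot> F')"
    and hcomp_id_left: "\<lbrakk>F \<in> hom1 C A B; \<alpha> \<in> hom2 C F F'\<rbrakk> \<Longrightarrow> id2 C (id1 C B) \<star> \<alpha> = \<alpha>"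
    and hcomp_id_right: "\<lbrakk>F \<in> hom1 C A B; \<alpha> \<in> hom2 C F F'\<rbrakk> \<Longrightarrow> \<alpha> \<star> id2 C (id1 C A) = \<alpha>"
    and hcomp_assoc: "\<lbrakk>F \<in> hom1 C A B; G \<in> hom1 C B D; H \<in> hom1 C D E;
          \<alpha> \<in> hom2 C F F'; \<beta> \<in> hom2 C G G'; \<gamma> \<in> hom2 C H H'\<rbrakk>
          \<Longrightarrow> (\<gamma> \<star> \<beta>) \<star> \<alpha> = \<gamma> \<star> (\<beta> \<star> \<alpha>)"
    and hcomp_id2: "\<lbrakk>F \<in> hom1 C A B; G \<in> hom1 C B D\<rbrakk> \<Longrightarrow> id2 C G \<star> id2 C F = id2 C (G \<odot> F)"
    and interchange: "\<lbrakk>F \<in> hom1 C A B; G \<in> hom1 C B D;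
          \<alpha> \<in> hom2 C F F'; \<alpha>' \<in> hom2 C F' F''; \<beta> \<in> hom2 C G G'; \<beta>' \<in> hom2 C G' G''\<rbrakk>
          \<Longrightarrow> (\<beta>' \<cdot> \<beta>) \<star> (\<alpha>' \<cdot> \<alpha>) = (\<beta>' \<star> \<alpha>') \<cdot> (\<beta> \<star> \<alpha>)"

text \<open>
  The square with sides \<open>f : X \<rightarrow> Y\<close>, \<open>g : X \<rightarrow> Z\<close>, \<open>u : Y \<rightarrow> W\<close>, \<open>v : Z \<rightarrow> W\<close> in the
  category of 1-arrows \<open>A \<rightarrow> B\<close> and 2-arrows between them commutes: \<open>u \<cdot> f = v \<cdot> g\<close>.
\<close>

definition comm_square ::
  "('o, 'm, 't, 'z) two_cat_scheme \<Rightarrow> 'o \<Rightarrow> 'o \<Rightarrow> 't \<Rightarrow> 't \<Rightarrow> 't \<Rightarrow> 't \<Rightarrow> bool" where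
  "comm_square C A B f g u v \<longleftrightarrow>
     (\<exists>X\<in>hom1 C A B. \<exists>Y\<in>hom1 C A B. \<exists>Z\<in>hom1 C A B. \<exists>W\<in>hom1 C A B.
        f \<in> hom2 C X Y \<and> g \<in> hom2 C X Z \<and> u \<in> hom2 C Y W \<and> v \<in> hom2 C Z W) \<and>
     u \<cdot>\<^bsub>C\<^esub> f = v \<cdot>\<^bsub>C\<^esub> g"

definition pushout_square ::
  "('o, 'm, 't, 'z) two_cat_scheme \<Rightarrow> 'o \<Rightarrow> 'o \<Rightarrow> 't \<Rightarrow> 't \<Rightarrow> 't \<Rightarrow> 't \<Rightarrow> bool" where
  "pushout_square C A B f g u v \<longleftrightarrow> comm_square C A B f g u v \<and>
     (\<forall>u' v'. comm_square C A B f g u' v' \<longrightarrow>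
        (\<exists>!w. w \<in> hom2 C (cod2 C u) (cod2 C u') \<and> w \<cdot>\<^bsub>C\<^esub> u = u' \<and> w \<cdot>\<^bsub>C\<^esub> v = v'))"

definition pullback_square ::
  "('o, 'm, 't, 'z) two_cat_scheme \<Rightarrow> 'o \<Rightarrow> 'o \<Rightarrow> 't \<Rightarrow> 't \<Rightarrow> 't \<Rightarrow> 't \<Rightarrow> bool" where
  "pullback_square C A B f g u v \<longleftrightarrow> comm_square C A B f g u v \<and>
     (\<forall>f' g'. comm_square C A B f' g' u v \<longrightarrow>
        (\<exists>!w. w \<in> hom2 C (dom2 C f') (dom2 C f) \<and> f \<cdot>\<^bsub>C\<^esub> w = f' \<and> g \<cdot>\<^bsub>C\<^esub> w = g'))"

record ('o, 'm, 't) pointed_two_cat = "('o, 'm, 't) two_cat" +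
  final :: 'o  ("\<one>\<index>")

text \<open>
  The final object is final in the 2-categorical sense: each category of arrows into it
  has one object and one arrow.
\<close>

locale formal_2_category = strict_2_category C
  for C :: "('o, 'm, 't, 'z) pointed_two_cat_scheme" (structure) +
  assumes final_Ob: "\<one> \<in> Ob C"
    and final_unique: "A \<in> Ob C \<Longrightarrow> \<exists>F. hom1 C A \<one> = {F} \<and> hom2 C F F = {id2 C F}"
    and eval_pushout:
      "\<lbrakk>A0 \<in> Ob C; A1 \<in> Ob C; a \<in> hom1 C \<one> A0; pushout_square C A0 A1 f g u v\<rbrakk>
        \<Longrightarrow> pushout_square C \<one> A1 (f \<lhd> a) (g \<lhd> a) (u \<lhd> a) (v \<lhd> a)"
    and eval_pullback:
      "\<lbrakk>A0 \<in> Ob C; A1 \<in> Ob C; a \<in> hom1 C \<one> A0; pullback_square C A0 A1 f g u v\<rbrakk>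
        \<Longrightarrow> pullback_square C \<one> A1 (f \<lhd> a) (g \<lhd> a) (u \<lhd> a) (v \<lhd> a)"

text \<open>
  Objects and arrows of a formal category \<open>A\<close>. The value of \<open>F\<close> at an object \<open>a\<close> is
  \<open>F \<odot> a\<close>, its value at an arrow \<open>f\<close> is \<open>F \<rhd> f\<close>, and the component at \<open>a\<close> of a 2-arrow
  \<open>\<eta>\<close> is \<open>\<eta> \<lhd> a\<close>; composition of arrows of \<open>A\<close> is vertical composition.
\<close>

definition obj :: "('o, 'm, 't, 'z) pointed_two_cat_scheme \<Rightarrow> 'o \<Rightarrow> 'm set" where
  "obj C A = hom1 C \<one>\<^bsub>C\<^esub> A"

definition arr :: "('o, 'm, 't, 'z) pointed_two_cat_scheme \<Rightarrow> 'o \<Rightarrow> 'm \<Rightarrow> 'm \<Rightarrow> 't set" where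
  "arr C A a b = {f \<in> hom2 C a b. a \<in> obj C A \<and> b \<in> obj C A}"

definition cylinder ::
  "('o, 'm, 't, 'z) two_cat_scheme \<Rightarrow> 'o \<Rightarrow> 'm \<Rightarrow> 't \<Rightarrow> 't \<Rightarrow> bool" where
  "cylinder C A Cyl i0 i1 \<longleftrightarrow>
     Cyl \<in> hom1 C A A \<and> i0 \<in> hom2 C (id1 C A) Cyl \<and> i1 \<in> hom2 C (id1 C A) Cyl"

definition contraction_structure ::
  "('o, 'm, 't, 'z) two_cat_scheme \<Rightarrow> 'o \<Rightarrow> 'm \<Rightarrow> 't \<Rightarrow> 't \<Rightarrow> 't \<Rightarrow> bool" where
  "contraction_structure C A Cyl i0 i1 p \<longleftrightarrow>
     p \<in> hom2 C Cyl (id1 C A) \<and>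
     p \<cdot>\<^bsub>C\<^esub> i0 = id2 C (id1 C A) \<and> p \<cdot>\<^bsub>C\<^esub> i1 = id2 C (id1 C A)"

definition involution_structure ::
  "('o, 'm, 't, 'z) two_cat_scheme \<Rightarrow> 'm \<Rightarrow> 't \<Rightarrow> 't \<Rightarrow> 't \<Rightarrow> bool" where
  "involution_structure C Cyl i0 i1 v \<longleftrightarrow>
     v \<in> hom2 C Cyl Cyl \<and> v \<cdot>\<^bsub>C\<^esub> i0 = i1 \<and> v \<cdot>\<^bsub>C\<^esub> i1 = i0"

definition involution_compatible ::
  "('o, 'm, 't, 'z) two_cat_scheme \<Rightarrow> 't \<Rightarrow> 't \<Rightarrow> bool" where
  "involution_compatible C p v \<longleftrightarrow> p \<cdot>\<^bsub>C\<^esub> v = p"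

definition subdivision_structure ::
  "('o, 'm, 't, 'z) two_cat_scheme \<Rightarrow> 'o \<Rightarrow> 'm \<Rightarrow> 't \<Rightarrow> 't \<Rightarrow> 'm \<Rightarrow> 't \<Rightarrow> 't \<Rightarrow> 't \<Rightarrow> bool" where
  "subdivision_structure C A Cyl i0 i1 S r0 r1 s \<longleftrightarrow>
     S \<in> hom1 C A A \<and> r0 \<in> hom2 C Cyl S \<and> r1 \<in> hom2 C Cyl S \<and>
     pushout_square C A A i0 i1 r0 r1 \<and>
     s \<in> hom2 C Cyl S \<and> s \<cdot>\<^bsub>C\<^esub> i0 = r1 \<cdot>\<^bsub>C\<^esub> i0 \<and> s \<cdot>\<^bsub>C\<^esub> i1 = r0 \<cdot>\<^bsub>C\<^esub> i1"

definition lower_right_connection ::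
  "('o, 'm, 't, 'z) two_cat_scheme \<Rightarrow> 'm \<Rightarrow> 't \<Rightarrow> 't \<Rightarrow> 't \<Rightarrow> 't \<Rightarrow> bool" where
  "lower_right_connection C Cyl i0 i1 p \<Gamma> \<longleftrightarrow>
     \<Gamma> \<in> hom2 C (Cyl \<odot>\<^bsub>C\<^esub> Cyl) Cyl \<and>
     \<Gamma> \<cdot>\<^bsub>C\<^esub> (i1 \<lhd>\<^bsub>C\<^esub> Cyl) = id2 C Cyl \<and> \<Gamma> \<cdot>\<^bsub>C\<^esub> (Cyl \<rhd>\<^bsub>C\<^esub> i1) = id2 C Cyl \<and>
     \<Gamma> \<cdot>\<^bsub>C\<^esub> (i0 \<lhd>\<^bsub>C\<^esub> Cyl) = i0 \<cdot>\<^bsub>C\<^esub> p \<and> \<Gamma> \<cdot>\<^bsub>C\<^esub> (Cyl \<rhd>\<^bsub>C\<^esub> i0) = i0 \<cdot>\<^bsub>C\<^esub> p"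

definition connection_compatible ::
  "('o, 'm, 't, 'z) two_cat_scheme \<Rightarrow> 'm \<Rightarrow> 't \<Rightarrow> 't \<Rightarrow> bool" where
  "connection_compatible C Cyl p \<Gamma> \<longleftrightarrow> p \<cdot>\<^bsub>C\<^esub> \<Gamma> = p \<cdot>\<^bsub>C\<^esub> (p \<lhd>\<^bsub>C\<^esub> Cyl)"

definition q_l ::
  "('o, 'm, 't, 'z) two_cat_scheme \<Rightarrow> 'm \<Rightarrow> 't \<Rightarrow> 't \<Rightarrow> 'm \<Rightarrow> 't \<Rightarrow> 't \<Rightarrow> 't" where
  "q_l C Cyl i0 p S r0 r1 =
     (THE q. q \<in> hom2 C S Cyl \<and> q \<cdot>\<^bsub>C\<^esub> r0 = id2 C Cyl \<and> q \<cdot>\<^bsub>C\<^esub> r1 = i0 \<cdot>\<^bsub>C\<^esub> p)"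

definition q_r ::
  "('o, 'm, 't, 'z) two_cat_scheme \<Rightarrow> 'm \<Rightarrow> 't \<Rightarrow> 't \<Rightarrow> 'm \<Rightarrow> 't \<Rightarrow> 't \<Rightarrow> 't" where
  "q_r C Cyl i1 p S r0 r1 =
     (THE q. q \<in> hom2 C S Cyl \<and> q \<cdot>\<^bsub>C\<^esub> r0 = i1 \<cdot>\<^bsub>C\<^esub> p \<and> q \<cdot>\<^bsub>C\<^esub> r1 = id2 C Cyl)"

definition strictness_of_identities ::
  "('o, 'm, 't, 'z) two_cat_scheme \<Rightarrow> 'm \<Rightarrow> 't \<Rightarrow> 't \<Rightarrow> 't \<Rightarrow> 'm \<Rightarrow> 't \<Rightarrow> 't \<Rightarrow> 't \<Rightarrow> bool" where
  "strictness_of_identities C Cyl i0 i1 p S r0 r1 s \<longleftrightarrow>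
     q_l C Cyl i0 p S r0 r1 \<cdot>\<^bsub>C\<^esub> s = id2 C Cyl \<and>
     q_r C Cyl i1 p S r0 r1 \<cdot>\<^bsub>C\<^esub> s = id2 C Cyl"

definition co_cylinder ::
  "('o, 'm, 't, 'z) two_cat_scheme \<Rightarrow> 'o \<Rightarrow> 'm \<Rightarrow> 't \<Rightarrow> 't \<Rightarrow> bool" where
  "co_cylinder C A coCyl e0 e1 \<longleftrightarrow>
     coCyl \<in> hom1 C A A \<and> e0 \<in> hom2 C coCyl (id1 C A) \<and> e1 \<in> hom2 C coCyl (id1 C A)"

definition co_contraction_structure ::
  "('o, 'm, 't, 'z) two_cat_scheme \<Rightarrow> 'o \<Rightarrow> 'm \<Rightarrow> 't \<Rightarrow> 't \<Rightarrow> 't \<Rightarrow> bool" where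
  "co_contraction_structure C A coCyl e0 e1 c \<longleftrightarrow>
     c \<in> hom2 C (id1 C A) coCyl \<and>
     e0 \<cdot>\<^bsub>C\<^esub> c = id2 C (id1 C A) \<and> e1 \<cdot>\<^bsub>C\<^esub> c = id2 C (id1 C A)"

text \<open>
  \<open>L\<close> is left adjoint to \<open>R\<close> inside the 2-category: a unit and a counit satisfying the
  triangle identities are part of the data.
\<close>

definition adjunction ::
  "('o, 'm, 't, 'z) two_cat_scheme \<Rightarrow> 'o \<Rightarrow> 'm \<Rightarrow> 'm \<Rightarrow> 't \<Rightarrow> 't \<Rightarrow> bool" where
  "adjunction C A L R \<eta> \<epsilon> \<longleftrightarrow>
     L \<in> hom1 C A A \<and> R \<in> hom1 C A A \<and>
     \<eta> \<in> hom2 C (id1 C A) (R \<odot>\<^bsub>C\<^esub> L) \<and> \<epsilon> \<in> hom2 C (L \<odot>\<^bsub>C\<^esub> R) (id1 C A) \<and>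
     (\<epsilon> \<lhd>\<^bsub>C\<^esub> L) \<cdot>\<^bsub>C\<^esub> (L \<rhd>\<^bsub>C\<^esub> \<eta>) = id2 C L \<and>
     (R \<rhd>\<^bsub>C\<^esub> \<epsilon>) \<cdot>\<^bsub>C\<^esub> (\<eta> \<lhd>\<^bsub>C\<^esub> R) = id2 C R"

text \<open>The induced bijection from arrows \<open>L(a0) \<rightarrow> a1\<close> to arrows \<open>a0 \<rightarrow> R(a1)\<close>.\<close>

definition adj ::
  "('o, 'm, 't, 'z) two_cat_scheme \<Rightarrow> 'm \<Rightarrow> 't \<Rightarrow> 'm \<Rightarrow> 't \<Rightarrow> 't" where
  "adj C R \<eta> a0 h = (R \<rhd>\<^bsub>C\<^esub> h) \<cdot>\<^bsub>C\<^esub> (\<eta> \<lhd>\<^bsub>C\<^esub> a0)"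

definition cylinder_left_adjoint ::
  "('o, 'm, 't, 'z) pointed_two_cat_scheme \<Rightarrow> 'o \<Rightarrow> 'm \<Rightarrow> 't \<Rightarrow> 't \<Rightarrow> 'm \<Rightarrow> 't \<Rightarrow> 't
     \<Rightarrow> 't \<Rightarrow> 't \<Rightarrow> bool" where
  "cylinder_left_adjoint C A Cyl i0 i1 coCyl e0 e1 \<eta> \<epsilon> \<longleftrightarrow>
     adjunction C A Cyl coCyl \<eta> \<epsilon> \<and>
     (\<forall>a0\<in>obj C A. \<forall>a1\<in>obj C A. \<forall>h\<in>arr C A (Cyl \<odot>\<^bsub>C\<^esub> a0) a1.
        (e0 \<lhd>\<^bsub>C\<^esub> a1) \<cdot>\<^bsub>C\<^esub> adj C coCyl \<eta> a0 h = h \<cdot>\<^bsub>C\<^esub> (i0 \<lhd>\<^bsub>C\<^esub> a0) \<and>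
        (e1 \<lhd>\<^bsub>C\<^esub> a1) \<cdot>\<^bsub>C\<^esub> adj C coCyl \<eta> a0 h = h \<cdot>\<^bsub>C\<^esub> (i1 \<lhd>\<^bsub>C\<^esub> a0))"

definition adjunction_compatible ::
  "('o, 'm, 't, 'z) pointed_two_cat_scheme \<Rightarrow> 'o \<Rightarrow> 'm \<Rightarrow> 't \<Rightarrow> 't \<Rightarrow> 't \<Rightarrow> bool" where
  "adjunction_compatible C A coCyl \<eta> p c \<longleftrightarrow>
     (\<forall>a0\<in>obj C A. \<forall>a1\<in>obj C A. \<forall>f\<in>arr C A a0 a1.
        adj C coCyl \<eta> a0 (f \<cdot>\<^bsub>C\<^esub> (p \<lhd>\<^bsub>C\<^esub> a0)) = (c \<lhd>\<^bsub>C\<^esub> a1) \<cdot>\<^bsub>C\<^esub> f)"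

definition mapping_cylinder ::
  "('o, 'm, 't, 'z) pointed_two_cat_scheme \<Rightarrow> 'o \<Rightarrow> 'm \<Rightarrow> 't \<Rightarrow> 'm \<Rightarrow> 'm \<Rightarrow> 't
     \<Rightarrow> 'm \<Rightarrow> 't \<Rightarrow> 't \<Rightarrow> bool" where
  "mapping_cylinder C A Cyl i0 a0 a1 f af d0 d1 \<longleftrightarrow>
     f \<in> arr C A a0 a1 \<and> d0 \<in> arr C A (Cyl \<odot>\<^bsub>C\<^esub> a0) af \<and> d1 \<in> arr C A a1 af \<and>
     pushout_square C \<one>\<^bsub>C\<^esub> A (i0 \<lhd>\<^bsub>C\<^esub> a0) f d0 d1"

definition preserves_mapping_cylinders ::
  "('o, 'm, 't, 'z) pointed_two_cat_scheme \<Rightarrow> 'o \<Rightarrow> 'm \<Rightarrow> 't \<Rightarrow> bool" where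
  "preserves_mapping_cylinders C A Cyl i0 \<longleftrightarrow>
     (\<forall>a0 a1 f af d0 d1. mapping_cylinder C A Cyl i0 a0 a1 f af d0 d1 \<longrightarrow>
        pushout_square C \<one>\<^bsub>C\<^esub> A
          (Cyl \<rhd>\<^bsub>C\<^esub> (i0 \<lhd>\<^bsub>C\<^esub> a0)) (Cyl \<rhd>\<^bsub>C\<^esub> f) (Cyl \<rhd>\<^bsub>C\<^esub> d0) (Cyl \<rhd>\<^bsub>C\<^esub> d1))"

definition mapping_cylinder_factorisation ::
  "('o, 'm, 't, 'z) pointed_two_cat_scheme \<Rightarrow> 'o \<Rightarrow> 't \<Rightarrow> 't \<Rightarrow> 'm \<Rightarrow> 'm \<Rightarrow> 't
     \<Rightarrow> 'm \<Rightarrow> 't \<Rightarrow> 't \<Rightarrow> 't \<Rightarrow> 't \<Rightarrow> bool" where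
  "mapping_cylinder_factorisation C A i1 p a0 a1 f af d0 d1 j g \<longleftrightarrow>
     j = d0 \<cdot>\<^bsub>C\<^esub> (i1 \<lhd>\<^bsub>C\<^esub> a0) \<and>
     g \<in> arr C A af a1 \<and> g \<cdot>\<^bsub>C\<^esub> d0 = f \<cdot>\<^bsub>C\<^esub> (p \<lhd>\<^bsub>C\<^esub> a0) \<and> g \<cdot>\<^bsub>C\<^esub> d1 = id2 C a1"

definition normally_cloven_cofibration ::
  "('o, 'm, 't, 'z) pointed_two_cat_scheme \<Rightarrow> 'o \<Rightarrow> 'm \<Rightarrow> 't \<Rightarrow> 't \<Rightarrow> 'm \<Rightarrow> 'm \<Rightarrow> 't
     \<Rightarrow> bool" where
  "normally_cloven_cofibration C A Cyl i0 p a0 a1 j \<longleftrightarrow>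
     j \<in> arr C A a0 a1 \<and>
     (\<exists>k.
       (\<forall>a2. \<forall>g\<in>arr C A a1 a2. \<forall>h\<in>arr C A (Cyl \<odot>\<^bsub>C\<^esub> a0) a2.
          h \<cdot>\<^bsub>C\<^esub> (i0 \<lhd>\<^bsub>C\<^esub> a0) = g \<cdot>\<^bsub>C\<^esub> j \<longrightarrow>
            k a2 g h \<in> arr C A (Cyl \<odot>\<^bsub>C\<^esub> a1) a2 \<and>
            k a2 g h \<cdot>\<^bsub>C\<^esub> (Cyl \<rhd>\<^bsub>C\<^esub> j) = h \<and>
            k a2 g h \<cdot>\<^bsub>C\<^esub> (i0 \<lhd>\<^bsub>C\<^esub> a1) = g) \<and>
       (\<forall>a2. \<forall>g\<in>arr C A a1 a2.
          k a2 g (g \<cdot>\<^bsub>C\<^esub> j \<cdot>\<^bsub>C\<^esub> (p \<lhd>\<^bsub>C\<^esub> a0)) = g \<cdot>\<^bsub>C\<^esub> (p \<lhd>\<^bsub>C\<^esub> a1)) \<and>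
       (\<forall>a2 a3. \<forall>g\<in>arr C A a1 a2. \<forall>h\<in>arr C A (Cyl \<odot>\<^bsub>C\<^esub> a0) a2. \<forall>g'\<in>arr C A a2 a3.
          h \<cdot>\<^bsub>C\<^esub> (i0 \<lhd>\<^bsub>C\<^esub> a0) = g \<cdot>\<^bsub>C\<^esub> j \<longrightarrow>
            g' \<cdot>\<^bsub>C\<^esub> k a2 g h = k a3 (g' \<cdot>\<^bsub>C\<^esub> g) (g' \<cdot>\<^bsub>C\<^esub> h)))"

definition homotopy ::
  "('o, 'm, 't, 'z) pointed_two_cat_scheme \<Rightarrow> 'o \<Rightarrow> 'm \<Rightarrow> 't \<Rightarrow> 't \<Rightarrow> 'm \<Rightarrow> 'm
     \<Rightarrow> 't \<Rightarrow> 't \<Rightarrow> 't \<Rightarrow> bool" where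
  "homotopy C A coCyl e0 e1 a0 a1 f0 f1 h \<longleftrightarrow>
     f0 \<in> arr C A a0 a1 \<and> f1 \<in> arr C A a0 a1 \<and> h \<in> arr C A a0 (coCyl \<odot>\<^bsub>C\<^esub> a1) \<and>
     (e0 \<lhd>\<^bsub>C\<^esub> a1) \<cdot>\<^bsub>C\<^esub> h = f0 \<and> (e1 \<lhd>\<^bsub>C\<^esub> a1) \<cdot>\<^bsub>C\<^esub> h = f1"

definition homotopy_equivalence ::
  "('o, 'm, 't, 'z) pointed_two_cat_scheme \<Rightarrow> 'o \<Rightarrow> 'm \<Rightarrow> 't \<Rightarrow> 't \<Rightarrow> 'm \<Rightarrow> 'm \<Rightarrow> 't
     \<Rightarrow> bool" where
  "homotopy_equivalence C A coCyl e0 e1 a0 a1 f \<longleftrightarrow>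
     f \<in> arr C A a0 a1 \<and>
     (\<exists>f'\<in>arr C A a1 a0.
        (\<exists>h. homotopy C A coCyl e0 e1 a0 a0 (f' \<cdot>\<^bsub>C\<^esub> f) (id2 C a0) h) \<and>
        (\<exists>h. homotopy C A coCyl e0 e1 a1 a1 (f \<cdot>\<^bsub>C\<^esub> f') (id2 C a1) h))"

definition fibration ::
  "('o, 'm, 't, 'z) pointed_two_cat_scheme \<Rightarrow> 'o \<Rightarrow> 'm \<Rightarrow> 't \<Rightarrow> 'm \<Rightarrow> 'm \<Rightarrow> 't \<Rightarrow> bool" where
  "fibration C A coCyl e0 a1 a2 f \<longleftrightarrow>
     f \<in> arr C A a1 a2 \<and>
     (\<forall>a0. \<forall>g\<in>arr C A a0 a1. \<forall>h\<in>arr C A a0 (coCyl \<odot>\<^bsub>C\<^esub> a2).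
        (e0 \<lhd>\<^bsub>C\<^esub> a2) \<cdot>\<^bsub>C\<^esub> h = f \<cdot>\<^bsub>C\<^esub> g \<longrightarrow>
          (\<exists>k\<in>arr C A a0 (coCyl \<odot>\<^bsub>C\<^esub> a1).
             (coCyl \<rhd>\<^bsub>C\<^esub> f) \<cdot>\<^bsub>C\<^esub> k = h \<and> (e0 \<lhd>\<^bsub>C\<^esub> a1) \<cdot>\<^bsub>C\<^esub> k = g))"

definition trivial_fibration ::
  "('o, 'm, 't, 'z) pointed_two_cat_scheme \<Rightarrow> 'o \<Rightarrow> 'm \<Rightarrow> 't \<Rightarrow> 't \<Rightarrow> 'm \<Rightarrow> 'm \<Rightarrow> 't
     \<Rightarrow> bool" where
  "trivial_fibration C A coCyl e0 e1 a1 a2 f \<longleftrightarrow>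
     fibration C A coCyl e0 a1 a2 f \<and> homotopy_equivalence C A coCyl e0 e1 a1 a2 f"

context strict_2_category
begin

lemma hom2_hom1: "\<alpha> \<in> hom2 C F G \<Longrightarrow> F \<in> hom1 C A B \<longleftrightarrow> G \<in> hom1 C A B"
  using dom2_Ar1 cod2_Ar1 dom1_parallel cod1_parallel by (auto simp: hom1_def hom2_def)

lemma hom1_Ar1: "F \<in> hom1 C A B \<Longrightarrow> F \<in> Ar1 C"
  by (simp add: hom1_def)

lemma pushout_desc:
  assumes po: "pushout_square C A B f g u v"
    and u: "u \<in> hom2 C Y W" and v: "v \<in> hom2 C Z W"
    and u': "u' \<in> hom2 C Y W'" and v': "v' \<in> hom2 C Z W'"
    and eq: "u' \<cdot> f = v' \<cdot> g"
  shows "\<exists>!w. w \<in> hom2 C W W' \<and> w \<cdot> u = u' \<and> w \<cdot> v = v'"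
proof -
  have sq: "comm_square C A B f g u v"
    using po by (simp add: pushout_square_def)
  then obtain X Y1 Z1 W1 where h: "X \<in> hom1 C A B" "Y1 \<in> hom1 C A B" "Z1 \<in> hom1 C A B"
    "f \<in> hom2 C X Y1" "g \<in> hom2 C X Z1" "u \<in> hom2 C Y1 W1" "v \<in> hom2 C Z1 W1"
    unfolding comm_square_def by blast
  have [simp]: "Y1 = Y" "Z1 = Z" using h u v by (auto simp: hom2_def)
  have "W' \<in> hom1 C A B" using h u' hom2_hom1 by simp
  then have "comm_square C A B f g u' v'"
    unfolding comm_square_def using h u' v' eq by auto
  moreover have "cod2 C u = W" "cod2 C u' = W'" using u u' by (auto simp: hom2_def)
  ultimately show ?thesis using po unfolding pushout_square_def by metis
qed

lemma q_l_q_r_unique: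
  assumes cyl: "cylinder C A Cyl i0 i1" and con: "contraction_structure C A Cyl i0 i1 p"
    and sub: "subdivision_structure C A Cyl i0 i1 S r0 r1 s"
  shows "\<exists>!q. q \<in> hom2 C S Cyl \<and> q \<cdot> r0 = id2 C Cyl \<and> q \<cdot> r1 = i0 \<cdot> p"
    and "\<exists>!q. q \<in> hom2 C S Cyl \<and> q \<cdot> r0 = i1 \<cdot> p \<and> q \<cdot> r1 = id2 C Cyl"
proof -
  have i: "i0 \<in> hom2 C (id1 C A) Cyl" "i1 \<in> hom2 C (id1 C A) Cyl" "Cyl \<in> Ar1 C"
    using cyl by (auto simp: cylinder_def hom1_def)
  have p: "p \<in> hom2 C Cyl (id1 C A)" "p \<cdot> i0 = id2 C (id1 C A)" "p \<cdot> i1 = id2 C (id1 C A)"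
    using con by (auto simp: contraction_structure_def)
  have r: "pushout_square C A A i0 i1 r0 r1" "r0 \<in> hom2 C Cyl S" "r1 \<in> hom2 C Cyl S"
    using sub by (auto simp: subdivision_structure_def)
  have "(i0 \<cdot> p) \<cdot> i1 = i0" "(i1 \<cdot> p) \<cdot> i0 = i1"
    using vcomp_assoc[OF i(2) p(1) i(1)] vcomp_assoc[OF i(1) p(1) i(2)] p i
    by (auto simp: vcomp_id_right)
  moreover have "id2 C Cyl \<cdot> i0 = i0" "id2 C Cyl \<cdot> i1 = i1"
    using i by (auto simp: vcomp_id_left)
  ultimately show
    "\<exists>!q. q \<in> hom2 C S Cyl \<and> q \<cdot> r0 = id2 C Cyl \<and> q \<cdot> r1 = i0 \<cdot> p"
    "\<exists>!q. q \<in> hom2 C S Cyl \<and> q \<cdot> r0 = i1 \<cdot> p \<and> q \<cdot> r1 = id2 C Cyl"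
    using pushout_desc[OF r id2_hom[OF i(3)] vcomp_hom[OF p(1) i(1)]]
      pushout_desc[OF r vcomp_hom[OF p(1) i(2)] id2_hom[OF i(3)]] by auto
qed

end

context formal_2_category
begin

lemma component_hom:
  assumes "\<alpha> \<in> hom2 C F G" "F \<in> hom1 C A B" "a \<in> obj C A"
  shows "\<alpha> \<lhd> a \<in> hom2 C (F \<odot> a) (G \<odot> a)"
  using assms by (auto simp: rwhisker_def obj_def intro: hcomp_hom id2_hom hom1_Ar1)

lemma contraction_component:
  assumes x: "x \<in> hom2 C (id1 C A) Cyl" and p: "p \<in> hom2 C Cyl (id1 C A)"
    and px: "p \<cdot> x = id2 C (id1 C A)" and A: "A \<in> Ob C" and a: "a \<in> obj C A"
  shows "(p \<lhd> a) \<cdot> (x \<lhd> a) = id2 C a"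
proof -
  have a': "a \<in> hom1 C \<one> A" using a by (simp add: obj_def)
  have ia: "id2 C a \<in> hom2 C a a" using a' by (simp add: hom1_Ar1 id2_hom)
  have "(p \<lhd> a) \<cdot> (x \<lhd> a) = (p \<cdot> x) \<star> (id2 C a \<cdot> id2 C a)"
    using interchange[OF a' id1_hom[OF A] ia ia x p] by (simp add: rwhisker_def)
  also have "\<dots> = id2 C a"
    using px hcomp_id_left[OF a' ia] vcomp_id_left[OF ia] by simp
  finally show ?thesis .
qed

lemma mapping_cylinder_factorisation_unique:
  assumes A: "A \<in> Ob C" and cyl: "cylinder C A Cyl i0 i1"
    and con: "contraction_structure C A Cyl i0 i1 p"
    and mc: "mapping_cylinder C A Cyl i0 a0 a1 f af d0 d1"
  shows "\<exists>!g. mapping_cylinder_factorisation C A i1 p a0 a1 f af d0 d1 (d0 \<cdot> (i1 \<lhd> a0)) g"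
    and "mapping_cylinder_factorisation C A i1 p a0 a1 f af d0 d1 j g \<Longrightarrow> f = g \<cdot> j"
proof -
  have i: "i0 \<in> hom2 C (id1 C A) Cyl" "i1 \<in> hom2 C (id1 C A) Cyl" "Cyl \<in> hom1 C A A"
    using cyl by (auto simp: cylinder_def)
  have p: "p \<in> hom2 C Cyl (id1 C A)" "p \<cdot> i0 = id2 C (id1 C A)" "p \<cdot> i1 = id2 C (id1 C A)"
    using con by (auto simp: contraction_structure_def)
  have d: "a0 \<in> obj C A" "a1 \<in> obj C A" "af \<in> obj C A" "f \<in> hom2 C a0 a1"
      "d0 \<in> hom2 C (Cyl \<odot> a0) af" "d1 \<in> hom2 C a1 af"
      "pushout_square C \<one> A (i0 \<lhd> a0) f d0 d1"
    using mc by (auto simp: mapping_cylinder_def arr_def)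
  have ida: "id1 C A \<odot> a0 = a0" using d comp1_id_left by (auto simp: obj_def)
  have pa: "p \<lhd> a0 \<in> hom2 C (Cyl \<odot> a0) a0"
    using component_hom[OF p(1) i(3) d(1)] ida by simp
  have ia: "i0 \<lhd> a0 \<in> hom2 C a0 (Cyl \<odot> a0)" "i1 \<lhd> a0 \<in> hom2 C a0 (Cyl \<odot> a0)"
    using component_hom[OF i(1) id1_hom[OF A] d(1)] component_hom[OF i(2) id1_hom[OF A] d(1)] ida
    by auto
  have one: "id2 C a1 \<in> hom2 C a1 a1" using d id2_hom by (auto simp: obj_def hom1_def)
  have fp: "f \<cdot> (p \<lhd> a0) \<cdot> (x \<lhd> a0) = f" if "x = i0 \<or> x = i1" for x
    using that vcomp_assoc[OF ia(1) pa d(4)] vcomp_assoc[OF ia(2) pa d(4)]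
      contraction_component[OF i(1) p(1,2) A d(1)] contraction_component[OF i(2) p(1,3) A d(1)]
      vcomp_id_right[OF d(4)] by auto
  have "\<exists>!g. g \<in> hom2 C af a1 \<and> g \<cdot> d0 = f \<cdot> (p \<lhd> a0) \<and> g \<cdot> d1 = id2 C a1"
    using pushout_desc[OF d(7,5,6) vcomp_hom[OF pa d(4)] one] fp vcomp_id_left[OF d(4)] by simp
  then show "\<exists>!g. mapping_cylinder_factorisation C A i1 p a0 a1 f af d0 d1 (d0 \<cdot> (i1 \<lhd> a0)) g"
    using d by (simp add: mapping_cylinder_factorisation_def arr_def)
  show "f = g \<cdot> j" if "mapping_cylinder_factorisation C A i1 p a0 a1 f af d0 d1 j g"
    using that vcomp_assoc[OF ia(2) d(5)] fp[of i1]
    by (auto simp: mapping_cylinder_factorisation_def arr_def) (metis)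
qed

context
  fixes A L R \<eta> \<epsilon>
  assumes A: "A \<in> Ob C" and adjn: "adjunction C A L R \<eta> \<epsilon>"
begin

private lemma LR: "L \<in> hom1 C A A" "R \<in> hom1 C A A"
    "\<eta> \<in> hom2 C (id1 C A) (R \<odot> L)" "\<epsilon> \<in> hom2 C (L \<odot> R) (id1 C A)"
    "(\<epsilon> \<lhd> L) \<cdot> (L \<rhd> \<eta>) = id2 C L" "(R \<rhd> \<epsilon>) \<cdot> (\<eta> \<lhd> R) = id2 C R"
  using adjn by (auto simp: adjunction_def)

private lemma app_hom:
  "F \<in> hom1 C A A \<Longrightarrow> f \<in> hom2 C a b \<Longrightarrow> a \<in> obj C A \<Longrightarrow> F \<rhd> f \<in> hom2 C (F \<odot> a) (F \<odot> b)"
  unfolding lwhisker_def obj_def by (intro hcomp_hom[where B = A]) (auto intro: id2_hom hom1_Ar1)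

private lemma app_comp:
  assumes "F \<in> hom1 C A A" "f \<in> hom2 C a b" "g \<in> hom2 C b d" "a \<in> obj C A"
  shows "F \<rhd> (g \<cdot> f) = (F \<rhd> g) \<cdot> (F \<rhd> f)"
proof -
  have i: "id2 C F \<in> hom2 C F F" using assms(1) by (simp add: hom1_Ar1 id2_hom)
  show ?thesis
    using interchange[OF assms(4)[unfolded obj_def] assms(1,2,3) i i] vcomp_id_left[OF i]
    by (simp add: lwhisker_def)
qed

private lemma component_natural:
  assumes "\<alpha> \<in> hom2 C F G" "F \<in> hom1 C A A" "f \<in> hom2 C a b" "a \<in> obj C A"
  shows "(\<alpha> \<lhd> b) \<cdot> (F \<rhd> f) = (G \<rhd> f) \<cdot> (\<alpha> \<lhd> a)"
proof -
  have a: "a \<in> hom1 C \<one> A" using assms(4) by (simp add: obj_def)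
  have b: "b \<in> hom1 C \<one> A" using a hom2_hom1[OF assms(3)] by simp
  have G: "G \<in> hom1 C A A" using assms(2) hom2_hom1[OF assms(1)] by simp
  have i: "id2 C F \<in> hom2 C F F" "id2 C G \<in> hom2 C G G" "id2 C a \<in> hom2 C a a"
    "id2 C b \<in> hom2 C b b"
    using assms(2) G a b by (auto simp: hom1_Ar1 id2_hom)
  have "(\<alpha> \<lhd> b) \<cdot> (F \<rhd> f) = \<alpha> \<star> f"
    using interchange[OF a assms(2) assms(3) i(4) i(1) assms(1)]
      vcomp_id_right[OF assms(1)] vcomp_id_left[OF assms(3)]
    by (simp add: lwhisker_def rwhisker_def)
  moreover have "(G \<rhd> f) \<cdot> (\<alpha> \<lhd> a) = \<alpha> \<star> f"
    using interchange[OF a assms(2) i(3) assms(3) assms(1) i(2)]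
      vcomp_id_left[OF assms(1)] vcomp_id_right[OF assms(3)]
    by (simp add: lwhisker_def rwhisker_def)
  ultimately show ?thesis by simp
qed

private lemma whisker_assoc:
  assumes "F \<in> hom1 C A A" "G \<in> hom1 C A A" "a \<in> obj C A"
  shows "f \<in> hom2 C a b \<Longrightarrow> (F \<odot> G) \<rhd> f = F \<rhd> (G \<rhd> f)"
    and "\<alpha> \<in> hom2 C F F' \<Longrightarrow> \<alpha> \<lhd> (G \<odot> a) = (\<alpha> \<lhd> G) \<lhd> a"
    and "\<alpha> \<in> hom2 C G G' \<Longrightarrow> F \<rhd> (\<alpha> \<lhd> a) = (F \<rhd> \<alpha>) \<lhd> a"
proof -
  have a: "a \<in> hom1 C \<one> A" using assms(3) by (simp add: obj_def)
  have i: "id2 C F \<in> hom2 C F F" "id2 C G \<in> hom2 C G G" "id2 C a \<in> hom2 C a a"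
    using assms a by (auto simp: hom1_Ar1 id2_hom)
  show "f \<in> hom2 C a b \<Longrightarrow> (F \<odot> G) \<rhd> f = F \<rhd> (G \<rhd> f)"
    using hcomp_assoc[OF a assms(2,1) _ i(2,1)] hcomp_id2[OF assms(2,1)]
    by (simp add: lwhisker_def)
  show "\<alpha> \<in> hom2 C F F' \<Longrightarrow> \<alpha> \<lhd> (G \<odot> a) = (\<alpha> \<lhd> G) \<lhd> a"
    using hcomp_assoc[OF a assms(2,1) i(3,2)] hcomp_id2[OF a assms(2)]
    by (simp add: rwhisker_def)
  show "\<alpha> \<in> hom2 C G G' \<Longrightarrow> F \<rhd> (\<alpha> \<lhd> a) = (F \<rhd> \<alpha>) \<lhd> a"
    using hcomp_assoc[OF a assms(2,1) i(3) _ i(1)] by (simp add: lwhisker_def rwhisker_def)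
qed

private lemma component_comp:
  assumes "\<alpha> \<in> hom2 C F G" "\<beta> \<in> hom2 C G H" "F \<in> hom1 C A A" "a \<in> obj C A"
  shows "(\<beta> \<cdot> \<alpha>) \<lhd> a = (\<beta> \<lhd> a) \<cdot> (\<alpha> \<lhd> a)"
proof -
  have a: "a \<in> hom1 C \<one> A" using assms(4) by (simp add: obj_def)
  then have i: "id2 C a \<in> hom2 C a a" by (simp add: hom1_Ar1 id2_hom)
  show ?thesis using interchange[OF a assms(3) i i assms(1,2)] vcomp_id_left[OF i]
    by (simp add: rwhisker_def)
qed

private lemma obj_app: "F \<in> hom1 C A A \<Longrightarrow> a \<in> obj C A \<Longrightarrow> F \<odot> a \<in> obj C A"
  by (auto simp: obj_def intro: comp1_hom)

private lemma id_app: "a \<in> obj C A \<Longrightarrow> id1 C A \<odot> a = a"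
  by (auto simp: obj_def intro: comp1_id_left)

private lemma id_arr: "f \<in> hom2 C a b \<Longrightarrow> a \<in> obj C A \<Longrightarrow> id1 C A \<rhd> f = f"
  by (auto simp: obj_def lwhisker_def intro: hcomp_id_left)

private lemma comp_app:
  "F \<in> hom1 C A A \<Longrightarrow> G \<in> hom1 C A A \<Longrightarrow> a \<in> obj C A \<Longrightarrow> (F \<odot> G) \<odot> a = F \<odot> (G \<odot> a)"
  by (auto simp: obj_def intro: comp1_assoc)

private lemma unit_hom: "a \<in> obj C A \<Longrightarrow> \<eta> \<lhd> a \<in> hom2 C a (R \<odot> (L \<odot> a))"
  using component_hom[OF LR(3) id1_hom[OF A]] LR by (simp add: id_app comp_app)

private lemma counit_hom: "a \<in> obj C A \<Longrightarrow> \<epsilon> \<lhd> a \<in> hom2 C (L \<odot> (R \<odot> a)) a"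
  using component_hom[OF LR(4) comp1_hom[OF LR(2,1)]] LR by (simp add: id_app comp_app)

private lemma unit_natural:
  assumes "f \<in> hom2 C a b" "a \<in> obj C A"
  shows "(\<eta> \<lhd> b) \<cdot> f = (R \<rhd> (L \<rhd> f)) \<cdot> (\<eta> \<lhd> a)"
  using component_natural[OF LR(3) id1_hom[OF A] assms] whisker_assoc(1)[OF LR(2,1) assms(2,1)]
  by (simp add: id_arr[OF assms])

private lemma counit_natural:
  assumes "f \<in> hom2 C a b" "a \<in> obj C A"
  shows "(\<epsilon> \<lhd> b) \<cdot> (L \<rhd> (R \<rhd> f)) = f \<cdot> (\<epsilon> \<lhd> a)"
  using component_natural[OF LR(4) comp1_hom[OF LR(2,1)] assms] whisker_assoc(1)[OF LR(1,2) assms(2,1)]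
  by (simp add: id_arr[OF assms])

private lemma whisk_hom:
  "F \<in> hom1 C A A \<Longrightarrow> G \<in> hom1 C A A \<Longrightarrow> \<alpha> \<in> hom2 C G H \<Longrightarrow> F \<rhd> \<alpha> \<in> hom2 C (F \<odot> G) (F \<odot> H)"
  "F \<in> hom1 C A A \<Longrightarrow> G \<in> hom1 C A A \<Longrightarrow> \<alpha> \<in> hom2 C G H \<Longrightarrow> \<alpha> \<lhd> F \<in> hom2 C (G \<odot> F) (H \<odot> F)"
  by (auto simp: lwhisker_def rwhisker_def intro: hcomp_hom id2_hom hom1_Ar1)

private lemma triangle_L:
  assumes a: "a \<in> obj C A"
  shows "(\<epsilon> \<lhd> (L \<odot> a)) \<cdot> (L \<rhd> (\<eta> \<lhd> a)) = id2 C (L \<odot> a)"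
proof -
  have h: "L \<rhd> \<eta> \<in> hom2 C L (L \<odot> (R \<odot> L))" "\<epsilon> \<lhd> L \<in> hom2 C (L \<odot> (R \<odot> L)) L"
    using whisk_hom(1)[OF LR(1) id1_hom[OF A] LR(3)] whisk_hom(2)[OF LR(1) comp1_hom[OF LR(2,1)] LR(4)]
      comp1_id_left[OF LR(1)] comp1_id_right[OF LR(1)] comp1_assoc[OF LR(1,2,1)] by auto
  show ?thesis
    using component_comp[OF h LR(1) a] LR(5) whisker_assoc(2)[OF comp1_hom[OF LR(2,1)] LR(1) a LR(4)]
      whisker_assoc(3)[OF LR(1) id1_hom[OF A] a LR(3)] hcomp_id2[OF a[unfolded obj_def] LR(1)]
    by (simp add: rwhisker_def)
qed

private lemma triangle_R:
  assumes a: "a \<in> obj C A"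
  shows "(R \<rhd> (\<epsilon> \<lhd> a)) \<cdot> (\<eta> \<lhd> (R \<odot> a)) = id2 C (R \<odot> a)"
proof -
  have h: "\<eta> \<lhd> R \<in> hom2 C R (R \<odot> (L \<odot> R))" "R \<rhd> \<epsilon> \<in> hom2 C (R \<odot> (L \<odot> R)) R"
    using whisk_hom(2)[OF LR(2) id1_hom[OF A] LR(3)] whisk_hom(1)[OF LR(2) comp1_hom[OF LR(2,1)] LR(4)]
      comp1_id_left[OF LR(2)] comp1_id_right[OF LR(2)] comp1_assoc[OF LR(2,1,2)] by auto
  show ?thesis
    using component_comp[OF h LR(2) a] LR(6) whisker_assoc(2)[OF id1_hom[OF A] LR(2) a LR(3)]
      whisker_assoc(3)[OF LR(2) comp1_hom[OF LR(2,1)] a LR(4)] hcomp_id2[OF a[unfolded obj_def] LR(2)]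
    by (simp add: rwhisker_def)
qed

lemma adj_hom:
  assumes "a0 \<in> obj C A" "h \<in> arr C A (L \<odot> a0) a1"
  shows "adj C R \<eta> a0 h \<in> arr C A a0 (R \<odot> a1)"
  using assms app_hom[OF LR(2), of h "L \<odot> a0" a1] unit_hom LR(2) obj_app
  by (auto simp: arr_def adj_def intro: vcomp_hom)

lemma adj_bij:
  assumes a: "a0 \<in> obj C A" "a1 \<in> obj C A"
  shows "bij_betw (adj C R \<eta> a0) (arr C A (L \<odot> a0) a1) (arr C A a0 (R \<odot> a1))"
proof (rule bij_betw_byWitness[where f' = "\<lambda>k. (\<epsilon> \<lhd> a1) \<cdot> (L \<rhd> k)"])
  show "\<forall>h\<in>arr C A (L \<odot> a0) a1. (\<epsilon> \<lhd> a1) \<cdot> (L \<rhd> adj C R \<eta> a0 h) = h"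
  proof
    fix h assume "h \<in> arr C A (L \<odot> a0) a1"
    then have h: "h \<in> hom2 C (L \<odot> a0) a1" and La: "L \<odot> a0 \<in> obj C A" by (auto simp: arr_def)
    have Rh: "R \<rhd> h \<in> hom2 C (R \<odot> (L \<odot> a0)) (R \<odot> a1)" by (rule app_hom[OF LR(2) h La])
    have LRh: "L \<rhd> (R \<rhd> h) \<in> hom2 C (L \<odot> (R \<odot> (L \<odot> a0))) (L \<odot> (R \<odot> a1))"
      by (rule app_hom[OF LR(1) Rh obj_app[OF LR(2) La]])
    have Le: "L \<rhd> (\<eta> \<lhd> a0) \<in> hom2 C (L \<odot> a0) (L \<odot> (R \<odot> (L \<odot> a0)))"
      by (rule app_hom[OF LR(1) unit_hom[OF a(1)] a(1)])
    have "(\<epsilon> \<lhd> a1) \<cdot> (L \<rhd> adj C R \<eta> a0 h) = ((\<epsilon> \<lhd> a1) \<cdot> (L \<rhd> (R \<rhd> h))) \<cdot> (L \<rhd> (\<eta> \<lhd> a0))"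
      using app_comp[OF LR(1) unit_hom[OF a(1)] Rh a(1)] vcomp_assoc[OF Le LRh counit_hom[OF a(2)]]
      by (simp add: adj_def)
    also have "\<dots> = h \<cdot> ((\<epsilon> \<lhd> (L \<odot> a0)) \<cdot> (L \<rhd> (\<eta> \<lhd> a0)))"
      using counit_natural[OF h La] vcomp_assoc[OF Le counit_hom[OF La] h] by simp
    also have "\<dots> = h" using triangle_L[OF a(1)] vcomp_id_right[OF h] by simp
    finally show "(\<epsilon> \<lhd> a1) \<cdot> (L \<rhd> adj C R \<eta> a0 h) = h" .
  qed
  show "\<forall>k\<in>arr C A a0 (R \<odot> a1). adj C R \<eta> a0 ((\<epsilon> \<lhd> a1) \<cdot> (L \<rhd> k)) = k"
  proof
    fix k assume "k \<in> arr C A a0 (R \<odot> a1)"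
    then have k: "k \<in> hom2 C a0 (R \<odot> a1)" and Ra: "R \<odot> a1 \<in> obj C A" by (auto simp: arr_def)
    have Lk: "L \<rhd> k \<in> hom2 C (L \<odot> a0) (L \<odot> (R \<odot> a1))" by (rule app_hom[OF LR(1) k a(1)])
    have RLk: "R \<rhd> (L \<rhd> k) \<in> hom2 C (R \<odot> (L \<odot> a0)) (R \<odot> (L \<odot> (R \<odot> a1)))"
      by (rule app_hom[OF LR(2) Lk obj_app[OF LR(1) a(1)]])
    have Re: "R \<rhd> (\<epsilon> \<lhd> a1) \<in> hom2 C (R \<odot> (L \<odot> (R \<odot> a1))) (R \<odot> a1)"
      by (rule app_hom[OF LR(2) counit_hom[OF a(2)] obj_app[OF LR(1) Ra]])
    have "adj C R \<eta> a0 ((\<epsilon> \<lhd> a1) \<cdot> (L \<rhd> k)) = (R \<rhd> (\<epsilon> \<lhd> a1)) \<cdot> ((R \<rhd> (L \<rhd> k)) \<cdot> (\<eta> \<lhd> a0))"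
      using app_comp[OF LR(2) Lk counit_hom[OF a(2)] obj_app[OF LR(1) a(1)]]
        vcomp_assoc[OF unit_hom[OF a(1)] RLk Re] by (simp add: adj_def)
    also have "\<dots> = ((R \<rhd> (\<epsilon> \<lhd> a1)) \<cdot> (\<eta> \<lhd> (R \<odot> a1))) \<cdot> k"
      using unit_natural[OF k a(1)] vcomp_assoc[OF k unit_hom[OF Ra] Re] by simp
    also have "\<dots> = k" using triangle_R[OF a(2)] vcomp_id_left[OF k] by simp
    finally show "adj C R \<eta> a0 ((\<epsilon> \<lhd> a1) \<cdot> (L \<rhd> k)) = k" .
  qed
  show "adj C R \<eta> a0 ` arr C A (L \<odot> a0) a1 \<subseteq> arr C A a0 (R \<odot> a1)"
    using adj_hom a by blast
  show "(\<lambda>k. (\<epsilon> \<lhd> a1) \<cdot> (L \<rhd> k)) ` arr C A a0 (R \<odot> a1) \<subseteq> arr C A (L \<odot> a0) a1"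
    using app_hom[OF LR(1) _ a(1)] counit_hom[OF a(2)] obj_app[OF LR(1) a(1)] a
    by (auto simp: arr_def intro: vcomp_hom)
qed

lemma adj_natural:
  assumes "h \<in> arr C A (L \<odot> a0) a1" "u \<in> arr C A b a0" "w \<in> arr C A a1 d"
  shows "adj C R \<eta> b (w \<cdot> h \<cdot> (L \<rhd> u)) = (R \<rhd> w) \<cdot> adj C R \<eta> a0 h \<cdot> u"
proof -
  have o: "a0 \<in> obj C A" "a1 \<in> obj C A" "b \<in> obj C A" "L \<odot> a0 \<in> obj C A" "L \<odot> b \<in> obj C A"
    using assms obj_app[OF LR(1)] by (auto simp: arr_def)
  have h: "h \<in> hom2 C (L \<odot> a0) a1" and u: "u \<in> hom2 C b a0" and w: "w \<in> hom2 C a1 d"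
    using assms by (auto simp: arr_def)
  note Lu = app_hom[OF LR(1) u o(3)]
  note RLu = app_hom[OF LR(2) Lu o(5)]
  note Rh = app_hom[OF LR(2) h o(4)]
  note Rw = app_hom[OF LR(2) w o(2)]
  note wh = vcomp_hom[OF h w]
  note Rwh = vcomp_hom[OF Rh Rw]
  have "adj C R \<eta> b (w \<cdot> h \<cdot> (L \<rhd> u)) = ((R \<rhd> w) \<cdot> (R \<rhd> h)) \<cdot> ((R \<rhd> (L \<rhd> u)) \<cdot> (\<eta> \<lhd> b))"
    using app_comp[OF LR(2) Lu wh o(5)] app_comp[OF LR(2) h w o(4)]
      vcomp_assoc[OF unit_hom[OF o(3)] RLu Rwh] by (simp add: adj_def)
  also have "\<dots> = ((R \<rhd> w) \<cdot> (R \<rhd> h)) \<cdot> (\<eta> \<lhd> a0) \<cdot> u"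
    using unit_natural[OF u o(3)] vcomp_assoc[OF u unit_hom[OF o(1)] Rwh] by simp
  also have "\<dots> = (R \<rhd> w) \<cdot> adj C R \<eta> a0 h \<cdot> u"
    using vcomp_assoc[OF unit_hom[OF o(1)] Rh Rw] by (simp add: adj_def)
  finally show ?thesis .
qed

end

end

end

theory Submission
  imports Defs
begin

text \<open>
  A homotopy \<open>Cyl(a) \<rightarrow> b\<close> is thought of as a path of arrows from \<open>a\<close> to \<open>b\<close>. The subdivision
  concatenates homotopies: two that meet glue to an arrow out of \<open>S(a)\<close>, which is then
  precomposed with \<open>s\<close>. This operation (\<open>hconcat\<close>) commutes with arrows out of the target, and
  strictness of identities says that a constant homotopy is a strict unit for it on either side
  (\<open>hconcat_const\<close>). Both halves of the theorem come down to concatenating two homotopies.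

  Cofibration. Let \<open>u : af \<rightarrow> b\<close> and \<open>h : Cyl(a0) \<rightarrow> b\<close> with \<open>h \<cdot> i0 = u \<cdot> j\<close>, and put
  \<open>w = u \<cdot> d0\<close>, so that the homotopy \<open>w\<close> ends where \<open>h\<close> begins. As \<open>Cyl\<close> preserves the mapping
  cylinder, an arrow out of \<open>Cyl(af)\<close> is a pair of compatible arrows out of \<open>Cyl(Cyl(a0))\<close> and
  \<open>Cyl(a1)\<close>. On \<open>Cyl(a1)\<close> the extension is taken constant. On \<open>Cyl(Cyl(a0))\<close> a square is needed
  with bottom edge \<open>w\<close>, left edge constant and right edge \<open>h\<close>. It is obtained by putting
  side by side the square that is constant on \<open>w\<close> and the connection square \<open>h \<cdot> \<Gamma>\<close>:

      bottom edge: \<open>w\<close> followed by the constant homotopy at the end of \<open>w\<close>, which is \<open>w\<close>;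
      left edge: the left edge of the first square, which is constant;
      right edge: the right edge of the second square, which is \<open>h\<close>.

  Transposing along the adjunction turns the two squares into homotopies in \<open>coCyl(b)\<close>, so that
  putting them side by side is an ordinary concatenation. All choices are canonical, which makes
  the extension natural in \<open>b\<close>. If \<open>h\<close> is constant then, by compatibility of \<open>\<Gamma>\<close> with \<open>p\<close>, the
  second square is constant as well and the unit law makes the whole extension constant.

  Trivial fibration. The arrow \<open>d1\<close> is a section of \<open>g\<close>, and \<open>d0 \<cdot> \<Gamma>\<close> together with \<open>d1 \<cdot> p\<close>
  defines a homotopy from \<open>d1 \<cdot> g\<close> to the identity that becomes constant after composition with
  \<open>g\<close> (\<open>deformation\<close>). So \<open>g\<close> is a homotopy equivalence. To lift a homotopy \<open>h\<close> that starts at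
  \<open>g \<cdot> u\<close>, run first through the reversed deformation from \<open>u\<close> to \<open>d1 \<cdot> g \<cdot> u\<close> and then through
  \<open>d1 \<cdot> h\<close>; after composition with \<open>g\<close> the first part is constant, and by the strict unit law the
  concatenation lies over \<open>h\<close> itself and not merely over a reparametrisation of it.
\<close>

section \<open>The category of objects and arrows of a formal category\<close>

locale formal_category = formal_2_category C
  for C :: "('o, 'm, 't, 'z) pointed_two_cat_scheme" (structure) +
  fixes A :: 'o
  assumes A_Ob: "A \<in> Ob C"
begin

text \<open>
  Arrows of \<open>A\<close> are collected in one set with source and target functions, because typing side
  conditions in this form are discharged by rewriting.
\<close>

definition mor :: "'t set" where
  "mor = {f \<in> Ar2 C. dom2 C f \<in> obj C A}"

lemma arr_iff: "f \<in> arr C A a b \<longleftrightarrow> f \<in> mor \<and> dom2 C f = a \<and> cod2 C f = b"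
  using hom2_hom1[of f a b "\<one>" A] by (auto simp: arr_def mor_def hom2_def obj_def)

lemma hom2_arr: "f \<in> hom2 C a b \<Longrightarrow> a \<in> obj C A \<Longrightarrow> f \<in> arr C A a b"
  using hom2_hom1[of f a b "\<one>" A] by (simp add: arr_def obj_def)

lemma arr_hom2: "f \<in> arr C A a b \<Longrightarrow> f \<in> hom2 C a b"
  by (simp add: arr_def)

lemma mor_hom2: "f \<in> mor \<Longrightarrow> f \<in> hom2 C (dom2 C f) (cod2 C f)"
  by (simp add: mor_def hom2_def)

lemma mor_dom [simp]: "f \<in> mor \<Longrightarrow> dom2 C f \<in> obj C A"
  by (simp add: mor_def)

lemma mor_cod [simp]: "f \<in> mor \<Longrightarrow> cod2 C f \<in> obj C A"
  using arr_iff[of f "dom2 C f" "cod2 C f"] by (simp add: arr_def)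

lemma mor_comp [simp]:
  assumes "f \<in> mor" "g \<in> mor" "cod2 C f = dom2 C g"
  shows "g \<cdot> f \<in> mor" "dom2 C (g \<cdot> f) = dom2 C f" "cod2 C (g \<cdot> f) = cod2 C g"
proof -
  have "g \<in> hom2 C (cod2 C f) (cod2 C g)" using mor_hom2[OF assms(2)] assms(3) by simp
  from vcomp_hom[OF mor_hom2[OF assms(1)] this]
  show "g \<cdot> f \<in> mor" "dom2 C (g \<cdot> f) = dom2 C f" "cod2 C (g \<cdot> f) = cod2 C g"
    using mor_dom[OF assms(1)] unfolding mor_def hom2_def by auto
qed

lemma mor_id [simp]:
  assumes "a \<in> obj C A"
  shows "id2 C a \<in> mor" "dom2 C (id2 C a) = a" "cod2 C (id2 C a) = a"
  using assms id2_hom[of a] by (auto simp: mor_def hom2_def obj_def hom1_def)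

lemma comp_id [simp]:
  assumes "f \<in> mor"
  shows "dom2 C f = a \<Longrightarrow> f \<cdot> id2 C a = f" "cod2 C f = a \<Longrightarrow> id2 C a \<cdot> f = f"
  using vcomp_id_left[OF mor_hom2[OF assms]] vcomp_id_right[OF mor_hom2[OF assms]] by simp_all

lemma comp_assoc [simp]:
  assumes "f \<in> mor" "g \<in> mor" "h \<in> mor" "cod2 C f = dom2 C g" "cod2 C g = dom2 C h"
  shows "(h \<cdot> g) \<cdot> f = h \<cdot> (g \<cdot> f)"
proof -
  have "g \<in> hom2 C (cod2 C f) (dom2 C h)" using mor_hom2[OF assms(2)] assms(4,5) by simp
  from vcomp_assoc[OF mor_hom2[OF assms(1)] this mor_hom2[OF assms(3)]] show ?thesis .
qed

text \<open>
  Composites are normalised by bracketing to the right, so an equation between composites of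
  two arrows also has to be available with a further arrow behind it.
\<close>

lemma comp_extend:
  assumes "g \<cdot> f = h" "x \<in> mor" "f \<in> mor" "g \<in> mor" "cod2 C x = dom2 C f" "cod2 C f = dom2 C g"
  shows "g \<cdot> (f \<cdot> x) = h \<cdot> x"
  using comp_assoc[OF assms(2-6)] assms(1) by simp

lemma app_obj [simp]: "F \<in> hom1 C A A \<Longrightarrow> a \<in> obj C A \<Longrightarrow> F \<odot> a \<in> obj C A"
  by (auto simp: obj_def intro: comp1_hom)

lemma component:
  assumes "\<alpha> \<in> hom2 C F G" "F \<in> hom1 C A A" "a \<in> obj C A"
  shows "\<alpha> \<lhd> a \<in> mor" "dom2 C (\<alpha> \<lhd> a) = F \<odot> a" "cod2 C (\<alpha> \<lhd> a) = G \<odot> a"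
  using hom2_arr[OF component_hom[OF assms] app_obj[OF assms(2,3)]] by (simp_all add: arr_iff)

lemma app_id_obj [simp]: "a \<in> obj C A \<Longrightarrow> id1 C A \<odot> a = a"
  by (auto simp: obj_def intro: comp1_id_left)

lemma app_comp_obj [simp]:
  "F \<in> hom1 C A A \<Longrightarrow> G \<in> hom1 C A A \<Longrightarrow> a \<in> obj C A \<Longrightarrow> (F \<odot> G) \<odot> a = F \<odot> (G \<odot> a)"
  by (auto simp: obj_def intro: comp1_assoc)

lemma app_mor [simp]:
  assumes "F \<in> hom1 C A A" "f \<in> mor"
  shows "F \<rhd> f \<in> mor" "dom2 C (F \<rhd> f) = F \<odot> dom2 C f" "cod2 C (F \<rhd> f) = F \<odot> cod2 C f"
proof -
  have a: "dom2 C f \<in> hom1 C \<one> A" using mor_dom[OF assms(2)] by (simp add: obj_def)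
  have "F \<rhd> f \<in> hom2 C (F \<odot> dom2 C f) (F \<odot> cod2 C f)"
    using hcomp_hom[OF a assms(1) mor_hom2[OF assms(2)] id2_hom[OF hom1_Ar1[OF assms(1)]]]
    by (simp add: lwhisker_def)
  from hom2_arr[OF this app_obj[OF assms(1) mor_dom[OF assms(2)]]]
show "F \<rhd> f \<in> mor" "dom2 C (F \<rhd> f) = F \<odot> dom2 C f" "cod2 C (F \<rhd> f) = F \<odot> cod2 C f"
    by (simp_all add: arr_iff)
qed

lemma app_comp [simp]:
  assumes "F \<in> hom1 C A A" "f \<in> mor" "g \<in> mor" "cod2 C f = dom2 C g"
  shows "F \<rhd> (g \<cdot> f) = (F \<rhd> g) \<cdot> (F \<rhd> f)"
proof -
  have i: "id2 C F \<in> hom2 C F F" using assms(1) by (simp add: hom1_Ar1 id2_hom)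
  have a: "dom2 C f \<in> hom1 C \<one> A" using mor_dom[OF assms(2)] by (simp add: obj_def)
  have g: "g \<in> hom2 C (cod2 C f) (cod2 C g)" using mor_hom2[OF assms(3)] assms(4) by simp
  show ?thesis
    using interchange[OF a assms(1) mor_hom2[OF assms(2)] g i i] vcomp_id_left[OF i]
    by (simp add: lwhisker_def)
qed

lemma natural:
  assumes "\<alpha> \<in> hom2 C F G" "F \<in> hom1 C A A" "f \<in> mor" "cod2 C f = b"
  shows "(\<alpha> \<lhd> b) \<cdot> (F \<rhd> f) = (G \<rhd> f) \<cdot> (\<alpha> \<lhd> dom2 C f)"
proof -
  let ?a = "dom2 C f"
  have f: "f \<in> hom2 C ?a b" using mor_hom2[OF assms(3)] assms(4) by simp
  have a: "?a \<in> hom1 C \<one> A" using mor_dom[OF assms(3)] by (simp add: obj_def)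
  have b: "b \<in> hom1 C \<one> A" using mor_cod[OF assms(3)] assms(4) by (simp add: obj_def)
  have G: "G \<in> hom1 C A A" using assms(2) hom2_hom1[OF assms(1)] by simp
  have i: "id2 C F \<in> hom2 C F F" "id2 C G \<in> hom2 C G G" "id2 C ?a \<in> hom2 C ?a ?a"
    "id2 C b \<in> hom2 C b b"
    using assms(2) G a b by (auto simp: hom1_Ar1 id2_hom)
  have "(\<alpha> \<lhd> b) \<cdot> (F \<rhd> f) = \<alpha> \<star> f"
    using interchange[OF a assms(2) f i(4) i(1) assms(1)]
      vcomp_id_right[OF assms(1)] vcomp_id_left[OF f]
    by (simp add: lwhisker_def rwhisker_def)
  moreover have "(G \<rhd> f) \<cdot> (\<alpha> \<lhd> ?a) = \<alpha> \<star> f"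
    using interchange[OF a assms(2) i(3) f assms(1) i(2)]
      vcomp_id_left[OF assms(1)] vcomp_id_right[OF f]
    by (simp add: lwhisker_def rwhisker_def)
  ultimately show ?thesis by simp
qed

lemma app_id_mor [simp]:
  assumes "f \<in> mor"
  shows "id1 C A \<rhd> f = f"
  using hcomp_id_left[OF _ mor_hom2[OF assms], of \<one> A] mor_dom[OF assms]
  by (simp only: lwhisker_def obj_def)

lemma component_comp:
  assumes "\<alpha> \<in> hom2 C F G" "\<beta> \<in> hom2 C G H" "F \<in> hom1 C A A" "a \<in> obj C A"
  shows "(\<beta> \<cdot> \<alpha>) \<lhd> a = (\<beta> \<lhd> a) \<cdot> (\<alpha> \<lhd> a)"
proof -
  have a: "a \<in> hom1 C \<one> A" using assms(4) by (simp add: obj_def)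
  then have i: "id2 C a \<in> hom2 C a a" by (simp add: hom1_Ar1 id2_hom)
  show ?thesis using interchange[OF a assms(3) i i assms(1,2)] vcomp_id_left[OF i]
    by (simp add: rwhisker_def)
qed

lemma component_id: "F \<in> hom1 C A A \<Longrightarrow> a \<in> obj C A \<Longrightarrow> id2 C F \<lhd> a = id2 C (F \<odot> a)"
  by (auto simp: rwhisker_def obj_def intro: hcomp_id2)

lemma app_id: "F \<in> hom1 C A A \<Longrightarrow> a \<in> obj C A \<Longrightarrow> F \<rhd> id2 C a = id2 C (F \<odot> a)"
  by (auto simp: lwhisker_def obj_def intro: hcomp_id2)

lemma component_whisker:
  assumes "F \<in> hom1 C A A" "G \<in> hom1 C A A" "a \<in> obj C A"
  shows "\<alpha> \<in> hom2 C F F' \<Longrightarrow> (\<alpha> \<lhd> G) \<lhd> a = \<alpha> \<lhd> (G \<odot> a)"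
    and "\<alpha> \<in> hom2 C G G' \<Longrightarrow> (F \<rhd> \<alpha>) \<lhd> a = F \<rhd> (\<alpha> \<lhd> a)"
proof -
  have a: "a \<in> hom1 C \<one> A" using assms(3) by (simp add: obj_def)
  have i: "id2 C F \<in> hom2 C F F" "id2 C G \<in> hom2 C G G" "id2 C a \<in> hom2 C a a"
    using assms a by (auto simp: hom1_Ar1 id2_hom)
  show "\<alpha> \<in> hom2 C F F' \<Longrightarrow> (\<alpha> \<lhd> G) \<lhd> a = \<alpha> \<lhd> (G \<odot> a)"
    using hcomp_assoc[OF a assms(2,1) i(3,2)] hcomp_id2[OF a assms(2)]
    by (simp add: rwhisker_def)
  show "\<alpha> \<in> hom2 C G G' \<Longrightarrow> (F \<rhd> \<alpha>) \<lhd> a = F \<rhd> (\<alpha> \<lhd> a)"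
    using hcomp_assoc[OF a assms(2,1) i(3) _ i(1)] by (simp add: lwhisker_def rwhisker_def)
qed

lemma whisker_hom:
  assumes "F \<in> hom1 C A A" "G \<in> hom1 C A A" "\<alpha> \<in> hom2 C G H"
  shows "F \<rhd> \<alpha> \<in> hom2 C (F \<odot> G) (F \<odot> H)" "\<alpha> \<lhd> F \<in> hom2 C (G \<odot> F) (H \<odot> F)"
  unfolding lwhisker_def rwhisker_def
  using hcomp_hom[OF assms(2,1,3) id2_hom] hcomp_hom[OF assms(1,2) id2_hom assms(3)] assms(1)
  by (simp_all add: hom1_Ar1)

lemma pushout_arr:
  assumes "pushout_square C \<one> A f g u w"
    and "u \<in> arr C A Y W" "w \<in> arr C A Z W" "u' \<in> arr C A Y W'" "w' \<in> arr C A Z W'"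
    and "u' \<cdot> f = w' \<cdot> g"
  shows "\<exists>!x. x \<in> arr C A W W' \<and> x \<cdot> u = u' \<and> x \<cdot> w = w'"
  using pushout_desc[OF assms(1) arr_hom2[OF assms(2)] arr_hom2[OF assms(3)] arr_hom2[OF assms(4)]
      arr_hom2[OF assms(5)] assms(6)] assms(2-5)
  by (simp add: arr_def)

lemma pushout_eqI:
  assumes "pushout_square C \<one> A f g u w"
    and "u \<in> arr C A Y W" "w \<in> arr C A Z W" "x \<in> arr C A W W'" "y \<in> arr C A W W'"
    and "x \<cdot> u = y \<cdot> u" "x \<cdot> w = y \<cdot> w"
  shows "x = y"
proof -
  obtain X where f: "f \<in> hom2 C X Y" "g \<in> hom2 C X Z" "X \<in> hom1 C \<one> A" and sq: "u \<cdot> f = w \<cdot> g"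
    using assms(1-3) by (auto simp: pushout_square_def comm_square_def arr_def hom2_def)
  have "f \<in> arr C A X Y" "g \<in> arr C A X Z"
    using hom2_arr[OF f(1)] hom2_arr[OF f(2)] f(3) by (simp_all add: obj_def)
  then have eq: "(x \<cdot> u) \<cdot> f = (x \<cdot> w) \<cdot> g"
    using assms(2-5) sq by (simp add: arr_iff)
  have xu: "x \<cdot> u \<in> arr C A Y W'" "x \<cdot> w \<in> arr C A Z W'"
    using assms(2-5) by (simp_all add: arr_iff)
  show ?thesis using pushout_arr[OF assms(1-3) xu eq] assms(4-7) by (metis (no_types))
qed

end

section \<open>Concatenation of homotopies\<close>

locale subdivided_cylinder = formal_category C A
  for C :: "('o, 'm, 't, 'z) pointed_two_cat_scheme" (structure) and A :: 'o +
  fixes Cyl S :: 'm and i0 i1 p v r0 r1 s \<Gamma> :: 't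
  assumes cyl: "cylinder C A Cyl i0 i1"
    and con: "contraction_structure C A Cyl i0 i1 p"
    and inv: "involution_structure C Cyl i0 i1 v"
    and inv_p: "involution_compatible C p v"
    and sub: "subdivision_structure C A Cyl i0 i1 S r0 r1 s"
    and lrc: "lower_right_connection C Cyl i0 i1 p \<Gamma>"
    and lrc_p: "connection_compatible C Cyl p \<Gamma>"
    and str: "strictness_of_identities C Cyl i0 i1 p S r0 r1 s"
begin

lemma Id_hom: "id1 C A \<in> hom1 C A A"
  using A_Ob by (rule id1_hom)

lemma Cyl_hom [simp]: "Cyl \<in> hom1 C A A"
  and S_hom [simp]: "S \<in> hom1 C A A"
  using cyl sub by (simp_all add: cylinder_def subdivision_structure_def)

lemma CylCyl_hom: "Cyl \<odot> Cyl \<in> hom1 C A A"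
  by (rule comp1_hom[OF Cyl_hom Cyl_hom])

lemma two_arrows:
  "i0 \<in> hom2 C (id1 C A) Cyl" "i1 \<in> hom2 C (id1 C A) Cyl" "p \<in> hom2 C Cyl (id1 C A)"
  "v \<in> hom2 C Cyl Cyl" "r0 \<in> hom2 C Cyl S" "r1 \<in> hom2 C Cyl S" "s \<in> hom2 C Cyl S"
  "\<Gamma> \<in> hom2 C (Cyl \<odot> Cyl) Cyl"
  using cyl con inv sub lrc
  by (simp_all add: cylinder_def contraction_structure_def involution_structure_def
      subdivision_structure_def lower_right_connection_def)

lemma components [simp]:
  assumes "a \<in> obj C A"
  shows "i0 \<lhd> a \<in> mor" "dom2 C (i0 \<lhd> a) = a" "cod2 C (i0 \<lhd> a) = Cyl \<odot> a"
    and "i1 \<lhd> a \<in> mor" "dom2 C (i1 \<lhd> a) = a" "cod2 C (i1 \<lhd> a) = Cyl \<odot> a"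
    and "p \<lhd> a \<in> mor" "dom2 C (p \<lhd> a) = Cyl \<odot> a" "cod2 C (p \<lhd> a) = a"
    and "v \<lhd> a \<in> mor" "dom2 C (v \<lhd> a) = Cyl \<odot> a" "cod2 C (v \<lhd> a) = Cyl \<odot> a"
    and "r0 \<lhd> a \<in> mor" "dom2 C (r0 \<lhd> a) = Cyl \<odot> a" "cod2 C (r0 \<lhd> a) = S \<odot> a"
    and "r1 \<lhd> a \<in> mor" "dom2 C (r1 \<lhd> a) = Cyl \<odot> a" "cod2 C (r1 \<lhd> a) = S \<odot> a"
    and "s \<lhd> a \<in> mor" "dom2 C (s \<lhd> a) = Cyl \<odot> a" "cod2 C (s \<lhd> a) = S \<odot> a"
    and "\<Gamma> \<lhd> a \<in> mor" "dom2 C (\<Gamma> \<lhd> a) = Cyl \<odot> (Cyl \<odot> a)" "cod2 C (\<Gamma> \<lhd> a) = Cyl \<odot> a"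
  using component[OF two_arrows(1) Id_hom assms] component[OF two_arrows(2) Id_hom assms]
    component[OF two_arrows(3) Cyl_hom assms] component[OF two_arrows(4) Cyl_hom assms]
    component[OF two_arrows(5) Cyl_hom assms] component[OF two_arrows(6) Cyl_hom assms]
    component[OF two_arrows(7) Cyl_hom assms] component[OF two_arrows(8) CylCyl_hom assms]
    app_id_obj[OF assms] app_comp_obj[OF Cyl_hom Cyl_hom assms]
  by simp_all

lemma naturality:
  assumes "f \<in> mor" "cod2 C f = b"
  shows "(i0 \<lhd> b) \<cdot> f = (Cyl \<rhd> f) \<cdot> (i0 \<lhd> dom2 C f)"
    and "(i1 \<lhd> b) \<cdot> f = (Cyl \<rhd> f) \<cdot> (i1 \<lhd> dom2 C f)"
    and "(p \<lhd> b) \<cdot> (Cyl \<rhd> f) = f \<cdot> (p \<lhd> dom2 C f)"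
  using natural[OF two_arrows(1) Id_hom assms] natural[OF two_arrows(2) Id_hom assms]
    natural[OF two_arrows(3) Cyl_hom assms] app_id_mor[OF assms(1)]
  by simp_all

lemma component_identities:
  assumes "a \<in> obj C A"
  shows p_i0: "(p \<lhd> a) \<cdot> (i0 \<lhd> a) = id2 C a"
    and p_i1: "(p \<lhd> a) \<cdot> (i1 \<lhd> a) = id2 C a"
    and v_i0: "(v \<lhd> a) \<cdot> (i0 \<lhd> a) = i1 \<lhd> a"
    and v_i1: "(v \<lhd> a) \<cdot> (i1 \<lhd> a) = i0 \<lhd> a"
    and p_v: "(p \<lhd> a) \<cdot> (v \<lhd> a) = p \<lhd> a"
    and s_i0: "(s \<lhd> a) \<cdot> (i0 \<lhd> a) = (r1 \<lhd> a) \<cdot> (i0 \<lhd> a)"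
    and s_i1: "(s \<lhd> a) \<cdot> (i1 \<lhd> a) = (r0 \<lhd> a) \<cdot> (i1 \<lhd> a)"
proof -
  note i = Id_hom and t = two_arrows
  have e: "p \<cdot> i0 = id2 C (id1 C A)" "p \<cdot> i1 = id2 C (id1 C A)" "v \<cdot> i0 = i1" "v \<cdot> i1 = i0" "p \<cdot> v = p"
    "s \<cdot> i0 = r1 \<cdot> i0" "s \<cdot> i1 = r0 \<cdot> i1"
    using con inv inv_p sub
    by (simp_all add: contraction_structure_def involution_structure_def
        involution_compatible_def subdivision_structure_def)
  show "(p \<lhd> a) \<cdot> (i0 \<lhd> a) = id2 C a"
    using component_comp[OF t(1,3) i assms] component_id[OF i assms] app_id_obj[OF assms]
    by (simp add: e)
  show "(p \<lhd> a) \<cdot> (i1 \<lhd> a) = id2 C a"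
    using component_comp[OF t(2,3) i assms] component_id[OF i assms] app_id_obj[OF assms]
    by (simp add: e)
  show "(v \<lhd> a) \<cdot> (i0 \<lhd> a) = i1 \<lhd> a"
    using component_comp[OF t(1,4) i assms] by (simp add: e)
  show "(v \<lhd> a) \<cdot> (i1 \<lhd> a) = i0 \<lhd> a"
    using component_comp[OF t(2,4) i assms] by (simp add: e)
  show "(p \<lhd> a) \<cdot> (v \<lhd> a) = p \<lhd> a"
    using component_comp[OF t(4,3) Cyl_hom assms] by (simp add: e)
  show "(s \<lhd> a) \<cdot> (i0 \<lhd> a) = (r1 \<lhd> a) \<cdot> (i0 \<lhd> a)"
    using component_comp[OF t(1,7) i assms] component_comp[OF t(1,6) i assms] by (simp add: e)
  show "(s \<lhd> a) \<cdot> (i1 \<lhd> a) = (r0 \<lhd> a) \<cdot> (i1 \<lhd> a)"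
    using component_comp[OF t(2,7) i assms] component_comp[OF t(2,5) i assms] by (simp add: e)
qed

lemma connection_identities:
  assumes "a \<in> obj C A"
  shows \<Gamma>_i1: "(\<Gamma> \<lhd> a) \<cdot> (i1 \<lhd> (Cyl \<odot> a)) = id2 C (Cyl \<odot> a)"
    and \<Gamma>_Cyl_i1: "(\<Gamma> \<lhd> a) \<cdot> (Cyl \<rhd> (i1 \<lhd> a)) = id2 C (Cyl \<odot> a)"
    and \<Gamma>_i0: "(\<Gamma> \<lhd> a) \<cdot> (i0 \<lhd> (Cyl \<odot> a)) = (i0 \<lhd> a) \<cdot> (p \<lhd> a)"
    and \<Gamma>_Cyl_i0: "(\<Gamma> \<lhd> a) \<cdot> (Cyl \<rhd> (i0 \<lhd> a)) = (i0 \<lhd> a) \<cdot> (p \<lhd> a)"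
    and p_\<Gamma>: "(p \<lhd> a) \<cdot> (\<Gamma> \<lhd> a) = (p \<lhd> a) \<cdot> (p \<lhd> (Cyl \<odot> a))"
proof -
  note t = two_arrows
  have u: "Cyl \<odot> id1 C A = Cyl" "id1 C A \<odot> Cyl = Cyl"
    using comp1_id_left[OF Cyl_hom] comp1_id_right[OF Cyl_hom] by simp_all
  note w = whisker_hom[OF Cyl_hom Id_hom t(1), unfolded u] whisker_hom[OF Cyl_hom Id_hom t(2), unfolded u]
    whisker_hom(2)[OF Cyl_hom Cyl_hom t(3), unfolded u]
  have e: "\<Gamma> \<cdot> (i1 \<lhd> Cyl) = id2 C Cyl" "\<Gamma> \<cdot> (Cyl \<rhd> i1) = id2 C Cyl"
    "\<Gamma> \<cdot> (i0 \<lhd> Cyl) = i0 \<cdot> p" "\<Gamma> \<cdot> (Cyl \<rhd> i0) = i0 \<cdot> p" "p \<cdot> \<Gamma> = p \<cdot> (p \<lhd> Cyl)"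
    using lrc lrc_p by (simp_all add: lower_right_connection_def connection_compatible_def)
  note c = component_comp[OF _ _ _ assms] and k = Cyl_hom
  note cw = component_whisker[OF Id_hom Cyl_hom assms] component_whisker[OF Cyl_hom Id_hom assms]
    component_whisker[OF Cyl_hom Cyl_hom assms]
  show "(\<Gamma> \<lhd> a) \<cdot> (i1 \<lhd> (Cyl \<odot> a)) = id2 C (Cyl \<odot> a)"
    using c[OF w(4) t(8) k] cw(1)[OF t(2)] component_id[OF k assms] by (simp add: e)
  show "(\<Gamma> \<lhd> a) \<cdot> (Cyl \<rhd> (i1 \<lhd> a)) = id2 C (Cyl \<odot> a)"
    using c[OF w(3) t(8) k] cw(4)[OF t(2)] component_id[OF k assms] by (simp add: e)
  show "(\<Gamma> \<lhd> a) \<cdot> (i0 \<lhd> (Cyl \<odot> a)) = (i0 \<lhd> a) \<cdot> (p \<lhd> a)"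
    using c[OF w(2) t(8) k] cw(1)[OF t(1)] c[OF t(3,1) k] by (simp add: e)
  show "(\<Gamma> \<lhd> a) \<cdot> (Cyl \<rhd> (i0 \<lhd> a)) = (i0 \<lhd> a) \<cdot> (p \<lhd> a)"
    using c[OF w(1) t(8) k] cw(4)[OF t(1)] c[OF t(3,1) k] by (simp add: e)
  show "(p \<lhd> a) \<cdot> (\<Gamma> \<lhd> a) = (p \<lhd> a) \<cdot> (p \<lhd> (Cyl \<odot> a))"
    using c[OF t(8,3) CylCyl_hom] cw(5)[OF t(3)] c[OF w(5) t(3) CylCyl_hom] by (simp add: e)
qed

text \<open>
  The subdivision is a pushout of endo-1-arrows of \<open>A\<close>; by the standing assumption on evaluation it
  is one at every object.
\<close>

lemma subdivision_pushout:
  "a \<in> obj C A \<Longrightarrow> pushout_square C \<one> A (i0 \<lhd> a) (i1 \<lhd> a) (r0 \<lhd> a) (r1 \<lhd> a)"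
  using eval_pushout[OF A_Ob A_Ob, of a i0 i1 r0 r1] sub
  by (simp add: subdivision_structure_def obj_def)

lemma subdivision_arr:
  "a \<in> obj C A \<Longrightarrow> r0 \<lhd> a \<in> arr C A (Cyl \<odot> a) (S \<odot> a)"
  "a \<in> obj C A \<Longrightarrow> r1 \<lhd> a \<in> arr C A (Cyl \<odot> a) (S \<odot> a)"
  by (simp_all add: arr_iff)

text \<open>
  The homotopies \<open>r0\<close> and \<open>r1\<close> meet in \<open>r0 \<cdot> i0 = r1 \<cdot> i1\<close>, and \<open>s\<close> runs from \<open>r1 \<cdot> i0\<close> to
  \<open>r0 \<cdot> i1\<close>. Thus \<open>r1\<close> is the half that is run through first, and it carries the first homotopy \<open>x\<close>.
\<close>

definition glue :: "'m \<Rightarrow> 't \<Rightarrow> 't \<Rightarrow> 't" where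
  "glue a x y = (THE m. m \<in> arr C A (S \<odot> a) (cod2 C x) \<and> m \<cdot> (r0 \<lhd> a) = y \<and> m \<cdot> (r1 \<lhd> a) = x)"

definition hconcat :: "'m \<Rightarrow> 't \<Rightarrow> 't \<Rightarrow> 't" where
  "hconcat a x y = glue a x y \<cdot> (s \<lhd> a)"

lemma glue:
  assumes "a \<in> obj C A" "x \<in> arr C A (Cyl \<odot> a) b" "y \<in> arr C A (Cyl \<odot> a) b"
    and "y \<cdot> (i0 \<lhd> a) = x \<cdot> (i1 \<lhd> a)"
  shows "glue a x y \<in> arr C A (S \<odot> a) b" "glue a x y \<cdot> (r0 \<lhd> a) = y" "glue a x y \<cdot> (r1 \<lhd> a) = x"
  using theI'[OF pushout_arr[OF subdivision_pushout[OF assms(1)] subdivision_arr[OF assms(1)] assms(3,2,4)]]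
    assms(2) by (simp_all add: glue_def arr_iff)

lemma glue_eqI:
  assumes "a \<in> obj C A" "m \<in> arr C A (S \<odot> a) b" "m' \<in> arr C A (S \<odot> a) b"
    and "m \<cdot> (r0 \<lhd> a) = m' \<cdot> (r0 \<lhd> a)" "m \<cdot> (r1 \<lhd> a) = m' \<cdot> (r1 \<lhd> a)"
  shows "m = m'"
  by (rule pushout_eqI[OF subdivision_pushout subdivision_arr]) (use assms in auto)

lemma hconcat_props:
  assumes "a \<in> obj C A" "x \<in> arr C A (Cyl \<odot> a) b" "y \<in> arr C A (Cyl \<odot> a) b"
    and "y \<cdot> (i0 \<lhd> a) = x \<cdot> (i1 \<lhd> a)"
  shows hconcat_arr: "hconcat a x y \<in> arr C A (Cyl \<odot> a) b"
    and hconcat_i0: "hconcat a x y \<cdot> (i0 \<lhd> a) = x \<cdot> (i0 \<lhd> a)"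
    and hconcat_i1: "hconcat a x y \<cdot> (i1 \<lhd> a) = y \<cdot> (i1 \<lhd> a)"
proof -
  note g = glue[OF assms]
  show "hconcat a x y \<in> arr C A (Cyl \<odot> a) b"
    using g(1) assms(1) by (simp add: hconcat_def arr_iff)
  show "hconcat a x y \<cdot> (i0 \<lhd> a) = x \<cdot> (i0 \<lhd> a)" "hconcat a x y \<cdot> (i1 \<lhd> a) = y \<cdot> (i1 \<lhd> a)"
    using g(1) assms(1) s_i0[OF assms(1)] s_i1[OF assms(1)] comp_extend[OF g(2), of "i1 \<lhd> a"]
      comp_extend[OF g(3), of "i0 \<lhd> a"]
    by (simp_all add: hconcat_def arr_iff)
qed

text \<open>
  Gluing is characterised by a universal property, hence commutes with arrows out of the target;
  the naturality of the cleavage below rests on this.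
\<close>

lemma hconcat_post:
  assumes "a \<in> obj C A" "x \<in> arr C A (Cyl \<odot> a) b" "y \<in> arr C A (Cyl \<odot> a) b"
    and "y \<cdot> (i0 \<lhd> a) = x \<cdot> (i1 \<lhd> a)" and "w \<in> arr C A b d"
  shows "w \<cdot> hconcat a x y = hconcat a (w \<cdot> x) (w \<cdot> y)"
proof -
  note g = glue[OF assms(1-4)]
  have wx: "w \<cdot> x \<in> arr C A (Cyl \<odot> a) d" "w \<cdot> y \<in> arr C A (Cyl \<odot> a) d"
    "(w \<cdot> y) \<cdot> (i0 \<lhd> a) = (w \<cdot> x) \<cdot> (i1 \<lhd> a)"
    using assms by (simp_all add: arr_iff)
  note g' = glue[OF assms(1) wx]
  have "w \<cdot> glue a x y = glue a (w \<cdot> x) (w \<cdot> y)"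
  proof (rule glue_eqI[OF assms(1)])
    show "w \<cdot> glue a x y \<in> arr C A (S \<odot> a) d" using g(1) assms(5) by (simp add: arr_iff)
  qed (use g g' assms(1,5) in \<open>simp_all add: arr_iff\<close>)
  moreover have "w \<cdot> (glue a x y \<cdot> (s \<lhd> a)) = (w \<cdot> glue a x y) \<cdot> (s \<lhd> a)"
    using g(1) assms(1,5) by (simp add: arr_iff)
  ultimately show ?thesis by (simp add: hconcat_def)
qed

text \<open>
  Gluing \<open>x\<close> to the constant homotopy at its start (end) is the same as composing \<open>x\<close> with the
  collapse \<open>q_l\<close> (\<open>q_r\<close>) of one half of the subdivision, and strictness of identities says that
  the collapse undoes \<open>s\<close>.
\<close>

lemma hconcat_const:
  assumes "a \<in> obj C A" "x \<in> arr C A (Cyl \<odot> a) b"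
  shows hconcat_const_left: "hconcat a (x \<cdot> ((i0 \<lhd> a) \<cdot> (p \<lhd> a))) x = x"
    and hconcat_const_right: "hconcat a x (x \<cdot> ((i1 \<lhd> a) \<cdot> (p \<lhd> a))) = x"
proof -
  let ?ql = "q_l C Cyl i0 p S r0 r1" and ?qr = "q_r C Cyl i1 p S r0 r1"
  note t = two_arrows and k = Cyl_hom and a = assms(1)
  have ql: "?ql \<in> hom2 C S Cyl" "?ql \<cdot> r0 = id2 C Cyl" "?ql \<cdot> r1 = i0 \<cdot> p"
    using theI'[OF q_l_q_r_unique(1)[OF cyl con sub]] by (simp_all add: q_l_def)
  have qr: "?qr \<in> hom2 C S Cyl" "?qr \<cdot> r0 = i1 \<cdot> p" "?qr \<cdot> r1 = id2 C Cyl"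
    using theI'[OF q_l_q_r_unique(2)[OF cyl con sub]] by (simp_all add: q_r_def)
  note c = component_comp[OF _ _ k a]
  note qla = component[OF ql(1) S_hom a] and qra = component[OF qr(1) S_hom a]
  have l: "(?ql \<lhd> a) \<cdot> (r0 \<lhd> a) = id2 C (Cyl \<odot> a)"
    "(?ql \<lhd> a) \<cdot> (r1 \<lhd> a) = (i0 \<lhd> a) \<cdot> (p \<lhd> a)" "(?ql \<lhd> a) \<cdot> (s \<lhd> a) = id2 C (Cyl \<odot> a)"
    using c[OF t(5) ql(1)] c[OF t(6) ql(1)] c[OF t(7) ql(1)] c[OF t(3,1)] component_id[OF k a] ql str
    by (simp_all add: strictness_of_identities_def)
  have r: "(?qr \<lhd> a) \<cdot> (r0 \<lhd> a) = (i1 \<lhd> a) \<cdot> (p \<lhd> a)"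
    "(?qr \<lhd> a) \<cdot> (r1 \<lhd> a) = id2 C (Cyl \<odot> a)" "(?qr \<lhd> a) \<cdot> (s \<lhd> a) = id2 C (Cyl \<odot> a)"
    using c[OF t(5) qr(1)] c[OF t(6) qr(1)] c[OF t(7) qr(1)] c[OF t(3,2)] component_id[OF k a] qr str
    by (simp_all add: strictness_of_identities_def)
  have h: "x \<cdot> ((i0 \<lhd> a) \<cdot> (p \<lhd> a)) \<in> arr C A (Cyl \<odot> a) b"
    "x \<cdot> ((i1 \<lhd> a) \<cdot> (p \<lhd> a)) \<in> arr C A (Cyl \<odot> a) b"
    "x \<cdot> (i0 \<lhd> a) = (x \<cdot> ((i0 \<lhd> a) \<cdot> (p \<lhd> a))) \<cdot> (i1 \<lhd> a)"
    "(x \<cdot> ((i1 \<lhd> a) \<cdot> (p \<lhd> a))) \<cdot> (i0 \<lhd> a) = x \<cdot> (i1 \<lhd> a)"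
    using assms by (simp_all add: arr_iff p_i0 p_i1)
  have "glue a (x \<cdot> ((i0 \<lhd> a) \<cdot> (p \<lhd> a))) x = x \<cdot> (?ql \<lhd> a)"
    by (rule glue_eqI[OF a glue(1)[OF a h(1) assms(2) h(3)]])
      (use glue(2,3)[OF a h(1) assms(2) h(3)] l qla assms in \<open>simp_all add: arr_iff\<close>)
  then show "hconcat a (x \<cdot> ((i0 \<lhd> a) \<cdot> (p \<lhd> a))) x = x"
    using l(3) qla assms by (simp add: hconcat_def arr_iff)
  have "glue a x (x \<cdot> ((i1 \<lhd> a) \<cdot> (p \<lhd> a))) = x \<cdot> (?qr \<lhd> a)"
    by (rule glue_eqI[OF a glue(1)[OF a assms(2) h(2,4)]])
      (use glue(2,3)[OF a assms(2) h(2,4)] r qra assms in \<open>simp_all add: arr_iff\<close>)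
  then show "hconcat a x (x \<cdot> ((i1 \<lhd> a) \<cdot> (p \<lhd> a))) = x"
    using r(3) qra assms by (simp add: hconcat_def arr_iff)
qed

end

section \<open>Transposition\<close>

locale adjoint_cylinder = subdivided_cylinder C A Cyl S i0 i1 p v r0 r1 s \<Gamma>
  for C :: "('o, 'm, 't, 'z) pointed_two_cat_scheme" (structure)
    and A :: 'o and Cyl S :: 'm and i0 i1 p v r0 r1 s \<Gamma> :: 't +
  fixes coCyl :: 'm and e0 e1 c \<eta> \<epsilon> :: 't
  assumes cocyl: "co_cylinder C A coCyl e0 e1"
    and cocon: "co_contraction_structure C A coCyl e0 e1 c"
    and ladj: "cylinder_left_adjoint C A Cyl i0 i1 coCyl e0 e1 \<eta> \<epsilon>"
    and ladj_c: "adjunction_compatible C A coCyl \<eta> p c"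
begin

lemma coCyl_hom [simp]: "coCyl \<in> hom1 C A A"
  using cocyl by (simp add: co_cylinder_def)

lemma co_two_arrows:
  "e0 \<in> hom2 C coCyl (id1 C A)" "e1 \<in> hom2 C coCyl (id1 C A)" "c \<in> hom2 C (id1 C A) coCyl"
  using cocyl cocon by (simp_all add: co_cylinder_def co_contraction_structure_def)

lemma co_components [simp]:
  assumes "a \<in> obj C A"
  shows "e0 \<lhd> a \<in> mor" "dom2 C (e0 \<lhd> a) = coCyl \<odot> a" "cod2 C (e0 \<lhd> a) = a"
    and "e1 \<lhd> a \<in> mor" "dom2 C (e1 \<lhd> a) = coCyl \<odot> a" "cod2 C (e1 \<lhd> a) = a"
    and "c \<lhd> a \<in> mor" "dom2 C (c \<lhd> a) = a" "cod2 C (c \<lhd> a) = coCyl \<odot> a"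
  using component[OF co_two_arrows(1) coCyl_hom assms] component[OF co_two_arrows(2) coCyl_hom assms]
    component[OF co_two_arrows(3) Id_hom assms] app_id_obj[OF assms]
  by simp_all

lemma c_natural: "f \<in> mor \<Longrightarrow> cod2 C f = b \<Longrightarrow> (c \<lhd> b) \<cdot> f = (coCyl \<rhd> f) \<cdot> (c \<lhd> dom2 C f)"
  using natural[OF co_two_arrows(3) Id_hom] by simp

lemma e_c:
  assumes "a \<in> obj C A"
  shows "(e0 \<lhd> a) \<cdot> (c \<lhd> a) = id2 C a" "(e1 \<lhd> a) \<cdot> (c \<lhd> a) = id2 C a"
  using component_comp[OF co_two_arrows(3,1) Id_hom assms]
    component_comp[OF co_two_arrows(3,2) Id_hom assms] component_id[OF Id_hom assms]
    app_id_obj[OF assms] cocon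
  by (simp_all add: co_contraction_structure_def)

text \<open>
  Transposition turns a square \<open>Cyl(Cyl(a)) \<rightarrow> b\<close> into a homotopy \<open>Cyl(a) \<rightarrow> coCyl(b)\<close>: the ends of
  that homotopy are the transposed faces for the inner \<open>Cyl\<close> (\<open>adjunct_pre\<close>), and composing it with
  \<open>e0\<close> and \<open>e1\<close> gives the faces for the outer one (\<open>e_adjunct\<close>). Constant squares in the outer
  direction correspond to composites with \<open>c\<close> (\<open>adjunct_const\<close>).
\<close>

abbreviation adjunct :: "'m \<Rightarrow> 't \<Rightarrow> 't" where
  "adjunct \<equiv> adj C coCyl \<eta>"

lemma adjn: "adjunction C A Cyl coCyl \<eta> \<epsilon>"
  using ladj by (simp add: cylinder_left_adjoint_def)

lemma adjunct_arr:
  "a \<in> obj C A \<Longrightarrow> h \<in> arr C A (Cyl \<odot> a) b \<Longrightarrow> adjunct a h \<in> arr C A a (coCyl \<odot> b)"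
  by (rule adj_hom[OF A_Ob adjn])

lemma adjunct_inject:
  assumes "a \<in> obj C A" "h \<in> arr C A (Cyl \<odot> a) b" "k \<in> arr C A (Cyl \<odot> a) b"
    and "adjunct a h = adjunct a k"
  shows "h = k"
proof -
  have "b \<in> obj C A" using assms(2) by (auto simp: arr_iff)
  from inj_onD[OF bij_betw_imp_inj_on[OF adj_bij[OF A_Ob adjn assms(1) this]] assms(4,2,3)]
  show ?thesis .
qed

lemma adjunct_surj:
  assumes "k \<in> arr C A a (coCyl \<odot> b)" "b \<in> obj C A"
  obtains h where "h \<in> arr C A (Cyl \<odot> a) b" "adjunct a h = k"
proof -
  have "a \<in> obj C A" using assms(1) by (auto simp: arr_iff)
  from bij_betw_imp_surj_on[OF adj_bij[OF A_Ob adjn this assms(2)]] assms(1) that show ?thesis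
    by (metis imageE)
qed

lemma adjunct_post:
  assumes "a \<in> obj C A" "h \<in> arr C A (Cyl \<odot> a) b" "w \<in> arr C A b d"
  shows "adjunct a (w \<cdot> h) = (coCyl \<rhd> w) \<cdot> adjunct a h"
proof -
  have "id2 C a \<in> arr C A a a" using assms(1) by (simp add: arr_iff)
  from adj_natural[OF A_Ob adjn assms(2) this assms(3)] adjunct_arr[OF assms(1,2)] assms
  show ?thesis by (simp add: arr_iff app_id)
qed

lemma adjunct_pre:
  assumes "h \<in> arr C A (Cyl \<odot> a) b" "u \<in> arr C A x a"
  shows "adjunct x (h \<cdot> (Cyl \<rhd> u)) = adjunct a h \<cdot> u"
proof -
  have o: "a \<in> obj C A" "b \<in> obj C A" using assms by (auto simp: arr_iff)
  then have "id2 C b \<in> arr C A b b" by (simp add: arr_iff)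
  from adj_natural[OF A_Ob adjn assms this] adjunct_arr[OF o(1) assms(1)] assms o
  show ?thesis by (simp add: arr_iff app_id)
qed

lemma e_adjunct:
  assumes "a \<in> obj C A" "h \<in> arr C A (Cyl \<odot> a) b"
  shows "(e0 \<lhd> b) \<cdot> adjunct a h = h \<cdot> (i0 \<lhd> a)" "(e1 \<lhd> b) \<cdot> adjunct a h = h \<cdot> (i1 \<lhd> a)"
  using ladj assms by (auto simp: cylinder_left_adjoint_def arr_def)

lemma adjunct_const:
  assumes "f \<in> arr C A a b"
  shows "adjunct a (f \<cdot> (p \<lhd> a)) = (c \<lhd> b) \<cdot> f"
  using ladj_c assms by (auto simp: adjunction_compatible_def arr_def)

end

section \<open>The mapping cylinder factorisation\<close>

locale factored_arrow = adjoint_cylinder C A Cyl S i0 i1 p v r0 r1 s \<Gamma> coCyl e0 e1 c \<eta> \<epsilon>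
  for C :: "('o, 'm, 't, 'z) pointed_two_cat_scheme" (structure)
    and A :: 'o and Cyl S coCyl :: 'm and i0 i1 p v r0 r1 s \<Gamma> e0 e1 c \<eta> \<epsilon> :: 't +
  fixes a0 a1 af :: 'm and f d0 d1 j g :: 't
  assumes pres: "preserves_mapping_cylinders C A Cyl i0"
    and mc: "mapping_cylinder C A Cyl i0 a0 a1 f af d0 d1"
    and fac: "mapping_cylinder_factorisation C A i1 p a0 a1 f af d0 d1 j g"
begin

lemma arrows:
  "f \<in> arr C A a0 a1" "d0 \<in> arr C A (Cyl \<odot> a0) af" "d1 \<in> arr C A a1 af" "g \<in> arr C A af a1"
  using mc fac by (simp_all add: mapping_cylinder_def mapping_cylinder_factorisation_def)

lemma objs [simp]: "a0 \<in> obj C A" "a1 \<in> obj C A" "af \<in> obj C A"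
  using arrows by (auto simp: arr_def)

lemma arrow_types [simp]:
  "f \<in> mor" "dom2 C f = a0" "cod2 C f = a1"
  "d0 \<in> mor" "dom2 C d0 = Cyl \<odot> a0" "cod2 C d0 = af"
  "d1 \<in> mor" "dom2 C d1 = a1" "cod2 C d1 = af"
  "g \<in> mor" "dom2 C g = af" "cod2 C g = a1"
  using arrows by (simp_all add: arr_iff)

lemma j_eq: "j = d0 \<cdot> (i1 \<lhd> a0)"
  and g_d0: "g \<cdot> d0 = f \<cdot> (p \<lhd> a0)"
  and g_d1: "g \<cdot> d1 = id2 C a1"
  using fac by (simp_all add: mapping_cylinder_factorisation_def)

lemma j_type [simp]: "j \<in> mor" "dom2 C j = a0" "cod2 C j = af"
  by (simp_all add: j_eq)

lemma mapping_cylinder_pushout: "pushout_square C \<one> A (i0 \<lhd> a0) f d0 d1"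
  using mc by (simp add: mapping_cylinder_def)

lemma d0_i0: "d0 \<cdot> (i0 \<lhd> a0) = d1 \<cdot> f"
  using mapping_cylinder_pushout by (simp add: pushout_square_def comm_square_def)

lemma Cyl_pushout:
  "pushout_square C \<one> A (Cyl \<rhd> (i0 \<lhd> a0)) (Cyl \<rhd> f) (Cyl \<rhd> d0) (Cyl \<rhd> d1)"
  using pres mc unfolding preserves_mapping_cylinders_def by blast

lemma Cyl_arrows:
  "Cyl \<rhd> d0 \<in> arr C A (Cyl \<odot> (Cyl \<odot> a0)) (Cyl \<odot> af)" "Cyl \<rhd> d1 \<in> arr C A (Cyl \<odot> a1) (Cyl \<odot> af)"
  by (simp_all add: arr_iff)

lemma af_eqI:
  assumes "x \<in> arr C A af b" "y \<in> arr C A af b" "x \<cdot> d0 = y \<cdot> d0" "x \<cdot> d1 = y \<cdot> d1"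
  shows "x = y"
  by (rule pushout_eqI[OF mapping_cylinder_pushout arrows(2,3) assms])

lemma Cyl_af_eqI:
  assumes "x \<in> arr C A (Cyl \<odot> af) b" "y \<in> arr C A (Cyl \<odot> af) b"
    and "x \<cdot> (Cyl \<rhd> d0) = y \<cdot> (Cyl \<rhd> d0)" "x \<cdot> (Cyl \<rhd> d1) = y \<cdot> (Cyl \<rhd> d1)"
  shows "x = y"
  by (rule pushout_eqI[OF Cyl_pushout Cyl_arrows assms])

section \<open>The inclusion is a normally cloven cofibration\<close>

text \<open>
  The transposed restriction of the extension to \<open>Cyl(Cyl(a0))\<close> is the concatenation of the
  transposes of the constant square \<open>u \<cdot> d0 \<cdot> p\<close> and of the connection square \<open>h \<cdot> \<Gamma>\<close>. Defining the
  extension by these two equations rather than by an explicit formula reduces normality and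
  naturality to checking the equations.
\<close>

definition lift :: "'m \<Rightarrow> 't \<Rightarrow> 't \<Rightarrow> 't" where
  "lift b u h = (THE k. k \<in> arr C A (Cyl \<odot> af) b \<and> k \<cdot> (Cyl \<rhd> d1) = u \<cdot> d1 \<cdot> (p \<lhd> a1)
     \<and> adjunct (Cyl \<odot> a0) (k \<cdot> (Cyl \<rhd> d0))
       = hconcat a0 ((c \<lhd> b) \<cdot> (u \<cdot> d0)) (adjunct (Cyl \<odot> a0) (h \<cdot> (\<Gamma> \<lhd> a0))))"

text \<open>
  Three of the faces of the connection square are used: the inner ones, which become the ends of its
  transpose, and the outer \<open>i0\<close>-face, which has to be constant for the unit law to apply to it.
\<close>

lemma adjunct_\<Gamma>:
  assumes "h \<in> arr C A (Cyl \<odot> a0) b"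
  shows "adjunct (Cyl \<odot> a0) (h \<cdot> (\<Gamma> \<lhd> a0)) \<in> arr C A (Cyl \<odot> a0) (coCyl \<odot> b)"
    and "adjunct (Cyl \<odot> a0) (h \<cdot> (\<Gamma> \<lhd> a0)) \<cdot> (i0 \<lhd> a0) = (c \<lhd> b) \<cdot> (h \<cdot> (i0 \<lhd> a0))"
    and "adjunct (Cyl \<odot> a0) (h \<cdot> (\<Gamma> \<lhd> a0)) \<cdot> (i1 \<lhd> a0) = adjunct a0 h"
    and "(e0 \<lhd> b) \<cdot> adjunct (Cyl \<odot> a0) (h \<cdot> (\<Gamma> \<lhd> a0)) = h \<cdot> ((i0 \<lhd> a0) \<cdot> (p \<lhd> a0))"
proof -
  have i: "i0 \<lhd> a0 \<in> arr C A a0 (Cyl \<odot> a0)" "i1 \<lhd> a0 \<in> arr C A a0 (Cyl \<odot> a0)"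
    by (simp_all add: arr_iff)
  have h: "h \<cdot> (\<Gamma> \<lhd> a0) \<in> arr C A (Cyl \<odot> (Cyl \<odot> a0)) b" "h \<cdot> (i0 \<lhd> a0) \<in> arr C A a0 b"
    using assms by (simp_all add: arr_iff)
  show "adjunct (Cyl \<odot> a0) (h \<cdot> (\<Gamma> \<lhd> a0)) \<in> arr C A (Cyl \<odot> a0) (coCyl \<odot> b)"
    by (rule adjunct_arr[OF _ h(1)]) simp
  show "adjunct (Cyl \<odot> a0) (h \<cdot> (\<Gamma> \<lhd> a0)) \<cdot> (i0 \<lhd> a0) = (c \<lhd> b) \<cdot> (h \<cdot> (i0 \<lhd> a0))"
    using adjunct_pre[OF h(1) i(1)] adjunct_const[OF h(2)] assms
    by (simp add: arr_iff \<Gamma>_Cyl_i0)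
  show "adjunct (Cyl \<odot> a0) (h \<cdot> (\<Gamma> \<lhd> a0)) \<cdot> (i1 \<lhd> a0) = adjunct a0 h"
    using adjunct_pre[OF h(1) i(2)] assms by (simp add: arr_iff \<Gamma>_Cyl_i1)
  show "(e0 \<lhd> b) \<cdot> adjunct (Cyl \<odot> a0) (h \<cdot> (\<Gamma> \<lhd> a0)) = h \<cdot> ((i0 \<lhd> a0) \<cdot> (p \<lhd> a0))"
    using e_adjunct(1)[OF _ h(1)] assms by (simp add: arr_iff \<Gamma>_i0)
qed

context
  fixes b u h
  assumes u: "u \<in> arr C A af b" and h: "h \<in> arr C A (Cyl \<odot> a0) b"
    and hu: "h \<cdot> (i0 \<lhd> a0) = u \<cdot> j"
begin

abbreviation (input) first where
  "first \<equiv> (c \<lhd> b) \<cdot> (u \<cdot> d0)"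

abbreviation (input) second where
  "second \<equiv> adjunct (Cyl \<odot> a0) (h \<cdot> (\<Gamma> \<lhd> a0))"

lemma u_type: "u \<in> mor" "dom2 C u = af" "cod2 C u = b" "b \<in> obj C A"
  and h_type: "h \<in> mor" "dom2 C h = Cyl \<odot> a0" "cod2 C h = b"
  using u h by (auto simp: arr_iff)

lemma first_arr: "first \<in> arr C A (Cyl \<odot> a0) (coCyl \<odot> b)"
  by (simp add: arr_iff u_type)

lemma second_start: "second \<cdot> (i0 \<lhd> a0) = first \<cdot> (i1 \<lhd> a0)"
  using adjunct_\<Gamma>(2)[OF h] by (simp add: hu j_eq u_type)

text \<open>
  The concatenation begins at the transpose of the left edge of the constant square, namely
  \<open>u \<cdot> d0 \<cdot> i0 \<cdot> p = u \<cdot> d1 \<cdot> f \<cdot> p = u \<cdot> d1 \<cdot> p \<cdot> Cyl(f)\<close>. So it agrees with the constant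
  homotopy \<open>u \<cdot> d1 \<cdot> p\<close> along the gluing of the mapping cylinder.
\<close>

lemma lift_ex1:
  "\<exists>!k. k \<in> arr C A (Cyl \<odot> af) b \<and> k \<cdot> (Cyl \<rhd> d1) = u \<cdot> d1 \<cdot> (p \<lhd> a1)
    \<and> adjunct (Cyl \<odot> a0) (k \<cdot> (Cyl \<rhd> d0)) = hconcat a0 first second"
proof -
  note [simp] = u_type h_type
  note hc = hconcat_props[OF objs(1) first_arr adjunct_\<Gamma>(1)[OF h] second_start]
  obtain K where K: "K \<in> arr C A (Cyl \<odot> (Cyl \<odot> a0)) b"
    "adjunct (Cyl \<odot> a0) K = hconcat a0 first second"
    using adjunct_surj[OF hc(1) u_type(4)] .
  have i: "i0 \<lhd> a0 \<in> arr C A a0 (Cyl \<odot> a0)" by (simp add: arr_iff)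
  have s: "u \<cdot> d0 \<cdot> (i0 \<lhd> a0) \<in> arr C A a0 b" by (simp add: arr_iff)
  have "K \<cdot> (Cyl \<rhd> (i0 \<lhd> a0)) = (u \<cdot> d0 \<cdot> (i0 \<lhd> a0)) \<cdot> (p \<lhd> a0)"
  proof (rule adjunct_inject[OF objs(1)])
    show "adjunct a0 (K \<cdot> (Cyl \<rhd> (i0 \<lhd> a0))) = adjunct a0 ((u \<cdot> d0 \<cdot> (i0 \<lhd> a0)) \<cdot> (p \<lhd> a0))"
      using adjunct_pre[OF K(1) i] K(2) hc(2) adjunct_const[OF s] by simp
  qed (use K(1) in \<open>simp_all add: arr_iff\<close>)
  then have sq: "K \<cdot> (Cyl \<rhd> (i0 \<lhd> a0)) = (u \<cdot> d1 \<cdot> (p \<lhd> a1)) \<cdot> (Cyl \<rhd> f)"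
    by (simp add: naturality(3) comp_extend[OF d0_i0])
  have q: "u \<cdot> d1 \<cdot> (p \<lhd> a1) \<in> arr C A (Cyl \<odot> a1) b" by (simp add: arr_iff)
  have "k \<cdot> (Cyl \<rhd> d0) = K \<longleftrightarrow> adjunct (Cyl \<odot> a0) (k \<cdot> (Cyl \<rhd> d0)) = hconcat a0 first second"
    if "k \<in> arr C A (Cyl \<odot> af) b" for k
    using adjunct_inject[OF _ _ K(1), of "k \<cdot> (Cyl \<rhd> d0)"] K(2) that by (auto simp: arr_iff)
  then show ?thesis
    using pushout_arr[OF Cyl_pushout Cyl_arrows K(1) q sq] by (metis (no_types, lifting))
qed

lemma lift:
  "lift b u h \<in> arr C A (Cyl \<odot> af) b"
  "lift b u h \<cdot> (Cyl \<rhd> d1) = u \<cdot> d1 \<cdot> (p \<lhd> a1)"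
  "adjunct (Cyl \<odot> a0) (lift b u h \<cdot> (Cyl \<rhd> d0)) = hconcat a0 first second"
  using theI'[OF lift_ex1] by (simp_all add: lift_def)

lemma lift_unique:
  assumes "k \<in> arr C A (Cyl \<odot> af) b" "k \<cdot> (Cyl \<rhd> d1) = u \<cdot> d1 \<cdot> (p \<lhd> a1)"
    and "adjunct (Cyl \<odot> a0) (k \<cdot> (Cyl \<rhd> d0)) = hconcat a0 first second"
  shows "lift b u h = k"
  unfolding lift_def using assms by (intro the1_equality[OF lift_ex1]) simp

lemma lift_type: "lift b u h \<in> mor" "dom2 C (lift b u h) = Cyl \<odot> af" "cod2 C (lift b u h) = b"
  using lift(1) by (simp_all add: arr_iff)

lemma lift_Cyl_j: "lift b u h \<cdot> (Cyl \<rhd> j) = h"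
proof (rule adjunct_inject[OF objs(1) _ h])
  note [simp] = u_type h_type lift_type
  have k: "lift b u h \<cdot> (Cyl \<rhd> d0) \<in> arr C A (Cyl \<odot> (Cyl \<odot> a0)) b"
    and i: "i1 \<lhd> a0 \<in> arr C A a0 (Cyl \<odot> a0)" by (simp_all add: arr_iff)
  show "adjunct a0 (lift b u h \<cdot> (Cyl \<rhd> j)) = adjunct a0 h"
    using adjunct_pre[OF k i] lift(3) adjunct_\<Gamma>(3)[OF h]
      hconcat_props(3)[OF objs(1) first_arr adjunct_\<Gamma>(1)[OF h] second_start]
    by (simp add: j_eq)
qed (simp add: arr_iff lift_type)

text \<open>
  Over the image of \<open>d0\<close> the \<open>i0\<close>-face is the bottom edge of the pasted square: \<open>u \<cdot> d0\<close> followed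
  by a constant homotopy. Here the right unit law is indispensable, as the face has to be \<open>u\<close> exactly.
\<close>

lemma lift_i0: "lift b u h \<cdot> (i0 \<lhd> af) = u"
proof (rule af_eqI[OF _ u])
  note [simp] = u_type h_type lift_type
  have e: "e0 \<lhd> b \<in> arr C A (coCyl \<odot> b) b" and x: "u \<cdot> d0 \<in> arr C A (Cyl \<odot> a0) b"
    and k: "lift b u h \<cdot> (Cyl \<rhd> d0) \<in> arr C A (Cyl \<odot> (Cyl \<odot> a0)) b"
    by (simp_all add: arr_iff)
  have "lift b u h \<cdot> (i0 \<lhd> af) \<cdot> d0 = lift b u h \<cdot> (Cyl \<rhd> d0) \<cdot> (i0 \<lhd> (Cyl \<odot> a0))"
    by (simp add: naturality(1)[of d0])
  also have "\<dots> = (e0 \<lhd> b) \<cdot> hconcat a0 first second"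
    using e_adjunct(1)[OF _ k] lift(3) by simp
  also have "\<dots> = hconcat a0 ((e0 \<lhd> b) \<cdot> first) ((e0 \<lhd> b) \<cdot> second)"
    by (rule hconcat_post[OF objs(1) first_arr adjunct_\<Gamma>(1)[OF h] second_start e])
  also have "\<dots> = hconcat a0 (u \<cdot> d0) (h \<cdot> ((i0 \<lhd> a0) \<cdot> (p \<lhd> a0)))"
    using adjunct_\<Gamma>(4)[OF h] by (simp add: comp_extend[OF e_c(1)])
  also have "h \<cdot> ((i0 \<lhd> a0) \<cdot> (p \<lhd> a0)) = (u \<cdot> d0) \<cdot> ((i1 \<lhd> a0) \<cdot> (p \<lhd> a0))"
    by (simp add: comp_extend[OF hu] j_eq)
  also have "hconcat a0 (u \<cdot> d0) \<dots> = u \<cdot> d0"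
    by (rule hconcat_const(2)[OF objs(1) x])
  finally show "lift b u h \<cdot> (i0 \<lhd> af) \<cdot> d0 = u \<cdot> d0" .
  have "lift b u h \<cdot> (i0 \<lhd> af) \<cdot> d1 = lift b u h \<cdot> (Cyl \<rhd> d1) \<cdot> (i0 \<lhd> a1)"
    by (simp add: naturality(1)[of d1])
  also have "\<dots> = u \<cdot> d1" by (simp add: lift(2) p_i0)
  finally show "lift b u h \<cdot> (i0 \<lhd> af) \<cdot> d1 = u \<cdot> d1" .
qed (simp add: arr_iff lift_type)

text \<open>
  Composing an extension with \<open>w\<close> gives the arrow that is characterised by the data composed with
  \<open>w\<close>, because concatenation, transposition and \<open>c\<close> are natural.
\<close>

lemma lift_post:
  assumes w: "w \<in> arr C A b d"
  shows "w \<cdot> lift b u h \<in> arr C A (Cyl \<odot> af) d"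
    and "w \<cdot> lift b u h \<cdot> (Cyl \<rhd> d1) = w \<cdot> u \<cdot> d1 \<cdot> (p \<lhd> a1)"
    and "adjunct (Cyl \<odot> a0) (w \<cdot> lift b u h \<cdot> (Cyl \<rhd> d0))
      = hconcat a0 ((c \<lhd> d) \<cdot> (w \<cdot> u \<cdot> d0)) (adjunct (Cyl \<odot> a0) (w \<cdot> h \<cdot> (\<Gamma> \<lhd> a0)))"
proof -
  note [simp] = u_type h_type lift_type
  have [simp]: "w \<in> mor" "dom2 C w = b" "cod2 C w = d" "d \<in> obj C A" using w by (auto simp: arr_iff)
  show "w \<cdot> lift b u h \<in> arr C A (Cyl \<odot> af) d" by (simp add: arr_iff)
  show "w \<cdot> lift b u h \<cdot> (Cyl \<rhd> d1) = w \<cdot> u \<cdot> d1 \<cdot> (p \<lhd> a1)" by (simp add: lift(2))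
  have k: "lift b u h \<cdot> (Cyl \<rhd> d0) \<in> arr C A (Cyl \<odot> (Cyl \<odot> a0)) b"
    and hG: "h \<cdot> (\<Gamma> \<lhd> a0) \<in> arr C A (Cyl \<odot> (Cyl \<odot> a0)) b"
    and Rw: "coCyl \<rhd> w \<in> arr C A (coCyl \<odot> b) (coCyl \<odot> d)"
    and oo: "Cyl \<odot> a0 \<in> obj C A"
    by (simp_all add: arr_iff)
  have "(coCyl \<rhd> w) \<cdot> first = (c \<lhd> d) \<cdot> (w \<cdot> u \<cdot> d0)"
    using comp_extend[OF c_natural[of w d, symmetric], of "u \<cdot> d0"] by simp
  then show "adjunct (Cyl \<odot> a0) (w \<cdot> lift b u h \<cdot> (Cyl \<rhd> d0))
      = hconcat a0 ((c \<lhd> d) \<cdot> (w \<cdot> u \<cdot> d0)) (adjunct (Cyl \<odot> a0) (w \<cdot> h \<cdot> (\<Gamma> \<lhd> a0)))"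
    using adjunct_post[OF oo k w] adjunct_post[OF oo hG w] lift(3)
      hconcat_post[OF objs(1) first_arr adjunct_\<Gamma>(1)[OF h] second_start Rw]
    by simp
qed

end

lemma lift_natural:
  assumes u: "u \<in> arr C A af b" and h: "h \<in> arr C A (Cyl \<odot> a0) b"
    and hu: "h \<cdot> (i0 \<lhd> a0) = u \<cdot> j" and w: "w \<in> arr C A b d"
  shows "w \<cdot> lift b u h = lift d (w \<cdot> u) (w \<cdot> h)"
proof -
  have "w \<cdot> u \<in> arr C A af d" "w \<cdot> h \<in> arr C A (Cyl \<odot> a0) d"
    "w \<cdot> h \<cdot> (i0 \<lhd> a0) = w \<cdot> u \<cdot> j"
    using assms by (simp_all add: arr_iff)
  from lift_unique[OF this lift_post[OF u h hu w]] show ?thesis by simp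
qed

text \<open>
  If \<open>h\<close> is constant, then so is \<open>h \<cdot> \<Gamma>\<close>, by compatibility of \<open>\<Gamma>\<close> with \<open>p\<close>. Its transpose is then
  the constant homotopy at the end of the first one, and disappears by the right unit law.
\<close>

lemma lift_normal:
  assumes u: "u \<in> arr C A af b"
  shows "lift b u (u \<cdot> j \<cdot> (p \<lhd> a0)) = u \<cdot> (p \<lhd> af)"
proof -
  have [simp]: "u \<in> mor" "dom2 C u = af" "cod2 C u = b" "b \<in> obj C A" using u by (auto simp: arr_iff)
  let ?h = "u \<cdot> j \<cdot> (p \<lhd> a0)"
  have x: "u \<cdot> d0 \<in> arr C A (Cyl \<odot> a0) b" "u \<cdot> (j \<cdot> (p \<lhd> a0)) \<in> arr C A (Cyl \<odot> a0) b"
    "(c \<lhd> b) \<cdot> (u \<cdot> d0) \<in> arr C A (Cyl \<odot> a0) (coCyl \<odot> b)"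
    by (simp_all add: arr_iff)
  show ?thesis
  proof (rule lift_unique[OF u])
    show "?h \<in> arr C A (Cyl \<odot> a0) b" by (simp add: arr_iff)
    show "?h \<cdot> (i0 \<lhd> a0) = u \<cdot> j" by (simp add: p_i0)
    show "u \<cdot> (p \<lhd> af) \<in> arr C A (Cyl \<odot> af) b" by (simp add: arr_iff)
    show "u \<cdot> (p \<lhd> af) \<cdot> (Cyl \<rhd> d1) = u \<cdot> d1 \<cdot> (p \<lhd> a1)" by (simp add: naturality(3)[of d1])
    have "adjunct (Cyl \<odot> a0) (u \<cdot> (p \<lhd> af) \<cdot> (Cyl \<rhd> d0)) = (c \<lhd> b) \<cdot> (u \<cdot> d0)"
      using adjunct_const[OF x(1)] by (simp add: naturality(3)[of d0])
    also have "\<dots> = hconcat a0 ((c \<lhd> b) \<cdot> (u \<cdot> d0)) (((c \<lhd> b) \<cdot> (u \<cdot> d0)) \<cdot> ((i1 \<lhd> a0) \<cdot> (p \<lhd> a0)))"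
      using hconcat_const(2)[OF objs(1) x(3)] by simp
    also have "((c \<lhd> b) \<cdot> (u \<cdot> d0)) \<cdot> ((i1 \<lhd> a0) \<cdot> (p \<lhd> a0)) = (c \<lhd> b) \<cdot> (u \<cdot> (j \<cdot> (p \<lhd> a0)))"
      by (simp add: j_eq)
    also have "\<dots> = adjunct (Cyl \<odot> a0) (?h \<cdot> (\<Gamma> \<lhd> a0))"
      using adjunct_const[OF x(2)] by (simp add: p_\<Gamma>)
    finally show "adjunct (Cyl \<odot> a0) (u \<cdot> (p \<lhd> af) \<cdot> (Cyl \<rhd> d0))
        = hconcat a0 ((c \<lhd> b) \<cdot> (u \<cdot> d0)) (adjunct (Cyl \<odot> a0) (?h \<cdot> (\<Gamma> \<lhd> a0)))" .
  qed
qed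

lemma normally_cloven_cofibration_j: "normally_cloven_cofibration C A Cyl i0 p a0 af j"
  unfolding normally_cloven_cofibration_def
proof (intro conjI exI[of _ lift] allI ballI impI)
  show "j \<in> arr C A a0 af" by (simp add: arr_iff)
qed (simp_all add: lift lift_Cyl_j lift_i0 lift_natural lift_normal)

section \<open>The retraction is a trivial fibration\<close>

text \<open>
  The connection deforms the collapse of \<open>Cyl(a0)\<close> onto its \<open>i0\<close>-end into the identity, and is
  constant on that end. As this is the end glued to \<open>a1\<close>, the constant homotopy on \<open>a1\<close> extends it
  to \<open>Cyl(af)\<close>.
\<close>

lemma deformation_ex1:
  "\<exists>!H. H \<in> arr C A (Cyl \<odot> af) af \<and> H \<cdot> (Cyl \<rhd> d0) = d0 \<cdot> (\<Gamma> \<lhd> a0) \<and> H \<cdot> (Cyl \<rhd> d1) = d1 \<cdot> (p \<lhd> a1)"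
  by (rule pushout_arr[OF Cyl_pushout Cyl_arrows])
    (simp_all add: arr_iff \<Gamma>_Cyl_i0 naturality(3)[of f] comp_extend[OF d0_i0])

definition deformation :: 't where
  "deformation = (THE H. H \<in> arr C A (Cyl \<odot> af) af \<and> H \<cdot> (Cyl \<rhd> d0) = d0 \<cdot> (\<Gamma> \<lhd> a0)
     \<and> H \<cdot> (Cyl \<rhd> d1) = d1 \<cdot> (p \<lhd> a1))"

lemma deformation:
  "deformation \<in> arr C A (Cyl \<odot> af) af"
  "deformation \<cdot> (Cyl \<rhd> d0) = d0 \<cdot> (\<Gamma> \<lhd> a0)" "deformation \<cdot> (Cyl \<rhd> d1) = d1 \<cdot> (p \<lhd> a1)"
  using theI'[OF deformation_ex1] by (simp_all add: deformation_def)

lemma deformation_type [simp]: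
  "deformation \<in> mor" "dom2 C deformation = Cyl \<odot> af" "cod2 C deformation = af"
  using deformation(1) by (simp_all add: arr_iff)

lemma deformation_i0: "deformation \<cdot> (i0 \<lhd> af) = d1 \<cdot> g"
proof (rule af_eqI)
  show "deformation \<cdot> (i0 \<lhd> af) \<cdot> d0 = d1 \<cdot> g \<cdot> d0"
    by (simp add: naturality(1)[of d0] comp_extend[OF deformation(2)] \<Gamma>_i0 g_d0 comp_extend[OF d0_i0])
  show "deformation \<cdot> (i0 \<lhd> af) \<cdot> d1 = d1 \<cdot> g \<cdot> d1"
    by (simp add: naturality(1)[of d1] comp_extend[OF deformation(3)] p_i0 g_d1)
qed (simp_all add: arr_iff)

lemma deformation_i1: "deformation \<cdot> (i1 \<lhd> af) = id2 C af"
proof (rule af_eqI)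
  show "deformation \<cdot> (i1 \<lhd> af) \<cdot> d0 = id2 C af \<cdot> d0"
    by (simp add: naturality(2)[of d0] comp_extend[OF deformation(2)] \<Gamma>_i1)
  show "deformation \<cdot> (i1 \<lhd> af) \<cdot> d1 = id2 C af \<cdot> d1"
    by (simp add: naturality(2)[of d1] comp_extend[OF deformation(3)] p_i1)
qed (simp_all add: arr_iff)

text \<open>
  The deformation moves within the fibres of \<open>g\<close>, since \<open>g\<close> is \<open>f \<cdot> p\<close> on \<open>Cyl(a0)\<close> and \<open>\<Gamma>\<close> is
  compatible with \<open>p\<close>.
\<close>

lemma g_deformation: "g \<cdot> deformation = g \<cdot> (p \<lhd> af)"
proof (rule Cyl_af_eqI)
  show "g \<cdot> deformation \<cdot> (Cyl \<rhd> d0) = g \<cdot> (p \<lhd> af) \<cdot> (Cyl \<rhd> d0)"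
    by (simp add: deformation(2) naturality(3)[of d0] comp_extend[OF g_d0] p_\<Gamma>)
  show "g \<cdot> deformation \<cdot> (Cyl \<rhd> d1) = g \<cdot> (p \<lhd> af) \<cdot> (Cyl \<rhd> d1)"
    by (simp add: deformation(3) naturality(3)[of d1])
qed (simp_all add: arr_iff)

lemma homotopy_equivalence_g: "homotopy_equivalence C A coCyl e0 e1 af a1 g"
  unfolding homotopy_equivalence_def homotopy_def
proof (intro conjI bexI[of _ d1] exI)
  show "adjunct af deformation \<in> arr C A af (coCyl \<odot> af)"
    by (rule adjunct_arr[OF objs(3) deformation(1)])
  show "(e0 \<lhd> af) \<cdot> adjunct af deformation = d1 \<cdot> g" "(e1 \<lhd> af) \<cdot> adjunct af deformation = id2 C af"
    using e_adjunct[OF objs(3) deformation(1)] by (simp_all add: deformation_i0 deformation_i1)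
  show "(e0 \<lhd> a1) \<cdot> (c \<lhd> a1) = g \<cdot> d1" "(e1 \<lhd> a1) \<cdot> (c \<lhd> a1) = id2 C a1"
    by (simp_all add: e_c g_d1)
qed (simp_all add: arr_iff)

text \<open>
  The homotopy \<open>d1 \<cdot> h\<close> lies over \<open>h\<close> but starts at \<open>d1 \<cdot> g \<cdot> u\<close> instead of \<open>u\<close>. Preceding it by
  the reversed deformation corrects the start, and the left unit law shows that the composite with \<open>g\<close>
  is unchanged.
\<close>

lemma g_lifts_homotopies:
  assumes u: "u \<in> arr C A b af" and h: "h \<in> arr C A (Cyl \<odot> b) a1" and hu: "h \<cdot> (i0 \<lhd> b) = g \<cdot> u"
  shows "\<exists>k \<in> arr C A (Cyl \<odot> b) af. g \<cdot> k = h \<and> k \<cdot> (i0 \<lhd> b) = u"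
proof -
  have [simp]: "u \<in> mor" "dom2 C u = b" "cod2 C u = af" "b \<in> obj C A"
    "h \<in> mor" "dom2 C h = Cyl \<odot> b" "cod2 C h = a1"
    using u h by (auto simp: arr_iff)
  let ?x = "deformation \<cdot> ((Cyl \<rhd> u) \<cdot> (v \<lhd> b))" and ?y = "d1 \<cdot> h"
  have b: "b \<in> obj C A" by simp
  have xy: "?x \<in> arr C A (Cyl \<odot> b) af" "?y \<in> arr C A (Cyl \<odot> b) af" by (simp_all add: arr_iff)
  have x0: "?x \<cdot> (i0 \<lhd> b) = u"
  proof -
    have "?x \<cdot> (i0 \<lhd> b) = (deformation \<cdot> (i1 \<lhd> af)) \<cdot> u" by (simp add: v_i0 naturality(2)[of u])
    then show ?thesis by (simp only: deformation_i1) simp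
  qed
  have x1: "?x \<cdot> (i1 \<lhd> b) = d1 \<cdot> (g \<cdot> u)"
  proof -
    have "?x \<cdot> (i1 \<lhd> b) = (deformation \<cdot> (i0 \<lhd> af)) \<cdot> u" by (simp add: v_i1 naturality(1)[of u])
    then show ?thesis by (simp only: deformation_i0) simp
  qed
  have y: "?y \<cdot> (i0 \<lhd> b) = ?x \<cdot> (i1 \<lhd> b)" using x1 hu by simp
  have gx: "g \<cdot> ?x = h \<cdot> ((i0 \<lhd> b) \<cdot> (p \<lhd> b))"
    by (simp add: comp_extend[OF g_deformation] comp_extend[OF naturality(3)[of u]] p_v comp_extend[OF hu])
  have gy: "g \<cdot> ?y = h" by (simp add: comp_extend[OF g_d1])
  have "g \<cdot> hconcat b ?x ?y = h"
    using hconcat_post[OF b xy y arrows(4)] gx gy hconcat_const(1)[OF b h] by simp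
  then show ?thesis using hconcat_props[OF b xy y] x0 by (intro bexI[of _ "hconcat b ?x ?y"]) simp_all
qed

lemma fibration_g: "fibration C A coCyl e0 af a1 g"
  unfolding fibration_def
proof (intro conjI allI ballI impI)
  fix b u h
  assume u: "u \<in> arr C A b af" and h: "h \<in> arr C A b (coCyl \<odot> a1)" and hu: "(e0 \<lhd> a1) \<cdot> h = g \<cdot> u"
  have b: "b \<in> obj C A" using u by (auto simp: arr_iff)
  obtain h' where h': "h' \<in> arr C A (Cyl \<odot> b) a1" "adjunct b h' = h"
    using adjunct_surj[OF h objs(2)] .
  have "h' \<cdot> (i0 \<lhd> b) = g \<cdot> u" using e_adjunct(1)[OF b h'(1)] h'(2) hu by simp
  from g_lifts_homotopies[OF u h'(1) this] obtain k
    where k: "k \<in> arr C A (Cyl \<odot> b) af" "g \<cdot> k = h'" "k \<cdot> (i0 \<lhd> b) = u" by blast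
  show "\<exists>k\<in>arr C A b (coCyl \<odot> af). (coCyl \<rhd> g) \<cdot> k = h \<and> (e0 \<lhd> af) \<cdot> k = u"
    using adjunct_arr[OF b k(1)] adjunct_post[OF b k(1) arrows(4)] e_adjunct(1)[OF b k(1)] k h'(2)
    by (intro bexI[of _ "adjunct b k"]) simp_all
qed (rule arrows(4))

end

theorem mainTheorem10:
  fixes C :: "('o, 'm, 't, 'z) pointed_two_cat_scheme" (structure)
    and A :: 'o
    and Cyl S coCyl a0 a1 af :: 'm
    and i0 i1 p v r0 r1 s \<Gamma> e0 e1 c \<eta> \<epsilon> f d0 d1 j g :: 't
  assumes "formal_2_category C"
    and "A \<in> Ob C"
    and "cylinder C A Cyl i0 i1"
    and "contraction_structure C A Cyl i0 i1 p"
    and "involution_structure C Cyl i0 i1 v"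
    and "involution_compatible C p v"
    and "subdivision_structure C A Cyl i0 i1 S r0 r1 s"
    and "lower_right_connection C Cyl i0 i1 p \<Gamma>"
    and "connection_compatible C Cyl p \<Gamma>"
    and "strictness_of_identities C Cyl i0 i1 p S r0 r1 s"
    and "preserves_mapping_cylinders C A Cyl i0"
    and "co_cylinder C A coCyl e0 e1"
    and "co_contraction_structure C A coCyl e0 e1 c"
    and "cylinder_left_adjoint C A Cyl i0 i1 coCyl e0 e1 \<eta> \<epsilon>"
    and "adjunction_compatible C A coCyl \<eta> p c"
    and "f \<in> arr C A a0 a1"
    and "mapping_cylinder C A Cyl i0 a0 a1 f af d0 d1"
    and "mapping_cylinder_factorisation C A i1 p a0 a1 f af d0 d1 j g"
  shows "normally_cloven_cofibration C A Cyl i0 p a0 af j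
    \<and> trivial_fibration C A coCyl e0 e1 af a1 g"
proof -
  interpret formal_2_category C by fact
  interpret factored_arrow C A Cyl S coCyl i0 i1 p v r0 r1 s \<Gamma> e0 e1 c \<eta> \<epsilon> a0 a1 af f d0 d1 j g
    by unfold_locales fact+
  show ?thesis
    using normally_cloven_cofibration_j fibration_g homotopy_equivalence_g
    by (simp add: trivial_fibration_def)
qed

end
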